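(* Let $X$ be a super-reflexive Banach space, $U\subset X$ an open set, $A\subset U$ relatively closed in $U$, and $f\colon A\to\mathbb R$. Then $f$ can be extended to a function $F\in C^{1,+}_{\mathrm{loc}}(U)$ if and only if $f$ is locally bounded and for each $x\in A$ there exist $\delta_x>0$ and a bounded $G_x\colon A\cap U(x,\delta_x)\to X^*$ such that $f|_{A\cap U(x,\delta_x)}$ satisfies condition $(\mathrm W_{G_x})$ (on $A\cap U(x,\delta_x)$).
   Context: All normed linear spaces are real; $\langle g,x\rangle=g(x)$ for $g\in X^*$, $x\in X$; $U(x,r)$ is the open ball in $X$ centred at $x$ with radius $r$; $Df$ denotes the Fréchet derivative. For an open subset $V$ of a normed linear space, $C^{1,+}(V)$ is the set of all Fréchet differentiable $f\colon V\to\mathbb R$ such that $Df$ is uniformly continuous on $V$. $C^{1,+}_{\mathrm{loc}}(U)$ is the set of all functions on $U$ which are locally $C^{1,+}$-smooth, i.e. every point of $U$ has an open neighbourhood $V\subset U$ such that the restriction of the function to $V$ is in $C^{1,+}(V)$. For $E\subset X$, $f\colon E\to\mathbb R$ and $G\colon E\to X^*$, we say that $f$ satisfies condition $(\mathrm W_G)$ (on $E$) if $G$ is uniformly continuous and for each $\varepsilon>0$ there exists $\delta>0$ such that $|f(y)-f(x)-\langle G(x),y-x\rangle|\le\varepsilon\|y-x\|$ whenever $x,y\in E$ and $\|y-x\|<\delta$. A Banach space is super-reflexive if and only if it has an equivalent uniformly smooth norm. *)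

theory Defs
  imports "HOL-Analysis.Analysis"
begin

definition equivalent_norm :: "('a::real_normed_vector \<Rightarrow> real) \<Rightarrow> bool" where
  "equivalent_norm N \<longleftrightarrow>
     (\<forall>x. 0 \<le> N x) \<and> (\<forall>x. N x = 0 \<longleftrightarrow> x = 0) \<and>
     (\<forall>x y. N (x + y) \<le> N x + N y) \<and> (\<forall>c x. N (c *\<^sub>R x) = \<bar>c\<bar> * N x) \<and>
     (\<exists>a>0. \<exists>b>0. \<forall>x. a * norm x \<le> N x \<and> N x \<le> b * norm x)"

text \<open>The modulus of smoothness of \<open>N\<close> at \<open>t\<close> is the supremum of
  \<open>(N (x + t y) + N (x - t y)) / 2 - 1\<close> over all \<open>x\<close>, \<open>y\<close> with \<open>N x = N y = 1\<close>;
  uniform smoothness says that it is \<open>o(t)\<close> as \<open>t\<close> tends to \<open>0\<close> from the right. The supremum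
  is unfolded because it would be unspecified on the zero space, whose unit sphere is empty.\<close>
definition uniformly_smooth :: "('a::real_vector \<Rightarrow> real) \<Rightarrow> bool" where
  "uniformly_smooth N \<longleftrightarrow>
     (\<forall>e>0. \<exists>d>0. \<forall>t. 0 < t \<and> t < d \<longrightarrow>
        (\<forall>x y. N x = 1 \<and> N y = 1 \<longrightarrow>
           (N (x + t *\<^sub>R y) + N (x - t *\<^sub>R y)) / 2 - 1 \<le> e * t))"

text \<open>Super-reflexivity is taken in the form of equivalent uniformly smooth renormability. (The
  description by finite representability quantifies over all Banach spaces, hence over types.)\<close>
definition super_reflexive :: "'a::banach itself \<Rightarrow> bool" where
  "super_reflexive _ \<longleftrightarrow> (\<exists>N :: 'a \<Rightarrow> real. equivalent_norm N \<and> uniformly_smooth N)"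

text \<open>The dual space is \<open>'a \<Rightarrow>\<^sub>L real\<close> with the operator norm. For open \<open>V\<close> only the values of
  \<open>f\<close> on \<open>V\<close> matter, and \<open>D\<close> is uniquely determined on \<open>V\<close>.\<close>
definition C1_plus_on :: "'a::real_normed_vector set \<Rightarrow> ('a \<Rightarrow> real) \<Rightarrow> bool" where
  "C1_plus_on V f \<longleftrightarrow>
     (\<exists>D :: 'a \<Rightarrow> ('a \<Rightarrow>\<^sub>L real).
        (\<forall>x\<in>V. (f has_derivative blinfun_apply (D x)) (at x)) \<and> uniformly_continuous_on V D)"

definition C1_plus_loc_on :: "'a::real_normed_vector set \<Rightarrow> ('a \<Rightarrow> real) \<Rightarrow> bool" where
  "C1_plus_loc_on U f \<longleftrightarrow> (\<forall>x\<in>U. \<exists>V. open V \<and> x \<in> V \<and> V \<subseteq> U \<and> C1_plus_on V f)"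

definition cond_W ::
  "'a::real_normed_vector set \<Rightarrow> ('a \<Rightarrow> real) \<Rightarrow> ('a \<Rightarrow> ('a \<Rightarrow>\<^sub>L real)) \<Rightarrow> bool" where
  "cond_W E f G \<longleftrightarrow>
     uniformly_continuous_on E G \<and>
     (\<forall>e>0. \<exists>d>0. \<forall>x\<in>E. \<forall>y\<in>E. norm (y - x) < d \<longrightarrow>
        \<bar>f y - f x - blinfun_apply (G x) (y - x)\<bar> \<le> e * norm (y - x))"

definition locally_bounded_on :: "'a::topological_space set \<Rightarrow> ('a \<Rightarrow> real) \<Rightarrow> bool" where
  "locally_bounded_on A f \<longleftrightarrow> (\<forall>x\<in>A. \<exists>V. open V \<and> x \<in> V \<and> bounded (f ` (A \<inter> V)))"

end

theory Submission
  imports Defs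
begin

text \<open>
  Necessity is the mean value inequality: near a point of \<open>A\<close> the derivative of an extension is
  bounded and uniformly continuous on a ball, and it serves as \<open>G\<close>.

  Sufficiency has a local and a global part. In the local part \<open>f\<close> and \<open>G\<close> are bounded on a set \<open>E\<close>,
  and \<open>f\<close> is extended to the whole space. Let \<open>\<phi>\<close> be a gauge with \<open>\<phi> 0 = 0\<close> that dominates the
  errors in condition W. Then
  \<open>g1 x = (SUP y\<in>E. f y + G y (x - y) - \<phi> (x - y))\<close> and
  \<open>g2 x = (INF y\<in>E. f y + G y (x - y) + \<phi> (x - y))\<close>
  satisfy \<open>g1 \<le> g2\<close>, and both agree with \<open>f\<close> on \<open>E\<close>, so it suffices to insert a smooth function between
  them. If \<open>\<phi>\<close> is semiconcave with a uniform modulus, then so is \<open>g2\<close>, and \<open>g1\<close> is semiconvex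
  with the same modulus. The largest semiconvex minorant \<open>h\<close> of \<open>g2\<close> lies above \<open>g1\<close>. It is also semiconcave:
  an average of two translates of \<open>h\<close>, lowered by the semiconcavity defect of \<open>g2\<close>, is again a
  semiconvex minorant of \<open>g2\<close>, hence lies below \<open>h\<close> (\<open>almost_convex_concave_insertion\<close>).
  A locally bounded function that is semiconvex and semiconcave with a modulus \<open>o(\<parallel>v\<parallel>)\<close> has difference quotients that
  converge uniformly, so its derivative is uniformly continuous
  (\<open>C1_plus_on_if_almost_convex_concave\<close>). The geometry of the space enters only through \<open>\<phi>\<close>, which is
  a weighted sum of the functions \<open>N\<^sup>2 / (b + N)\<close> with \<open>N\<close> a uniformly smooth norm and \<open>b\<close>
  running through a sequence of scales (\<open>smooth_gauge\<close>).

  In the global part, Stone's theorem refines a cover of \<open>U\<close> by balls to a cover that splits into countably many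
  levels, each of them uniformly discrete. The local extension
  theorem, applied to a function with values \<open>0\<close> and \<open>1\<close> on two sets at positive distance and to
  \<open>G = 0\<close>, supplies the cut-off functions on each level (\<open>C1_plus_separation\<close>). So it also yields the smooth
  partitions of unity that glue the local extensions (\<open>C1_plus_loc_on_glue\<close>).
\<close>

section \<open>Semiconvexity and insertion\<close>

text \<open>
  This is semiconvexity with a modulus \<open>o(\<parallel>a - b\<parallel>)\<close>, given by the threshold \<open>d e\<close> below which
  the error constant \<open>e\<close> is admissible; a fixed \<open>d\<close> describes a class of functions that is closed under suprema
  and translations. The factor \<open>l * (1 - l)\<close> is essential: it makes the two-sided condition control
  difference quotients at all smaller scales, whereas a two-sided midpoint condition with
  error \<open>o(\<parallel>a - b\<parallel>)\<close> does not even imply differentiability at every point.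
\<close>
definition almost_convex :: "(real \<Rightarrow> real) \<Rightarrow> ('a::real_normed_vector \<Rightarrow> real) \<Rightarrow> bool" where
  "almost_convex d u \<longleftrightarrow>
     (\<forall>e>0. \<forall>a b. \<forall>l. 0 \<le> l \<longrightarrow> l \<le> 1 \<longrightarrow> norm (a - b) < d e \<longrightarrow>
        u (l *\<^sub>R a + (1 - l) *\<^sub>R b) \<le> l * u a + (1 - l) * u b + l * (1 - l) * (e * norm (a - b)))"

lemma almost_convexD:
  assumes "almost_convex d u" "e > 0" "0 \<le> l" "l \<le> 1" "norm (a - b) < d e"
  shows "u (l *\<^sub>R a + (1 - l) *\<^sub>R b) \<le> l * u a + (1 - l) * u b + l * (1 - l) * (e * norm (a - b))"
  using assms unfolding almost_convex_def by blast

lemma almost_convex_SUP: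
  fixes K :: "('a::real_normed_vector \<Rightarrow> real) set"
  assumes "K \<noteq> {}" and bdd: "\<And>x. bdd_above ((\<lambda>u. u x) ` K)"
    and ac: "\<And>u. u \<in> K \<Longrightarrow> almost_convex d u"
  shows "almost_convex d (\<lambda>x. SUP u\<in>K. u x)"
  unfolding almost_convex_def
proof (intro allI impI)
  fix e l :: real and a b :: 'a
  assume h: "0 < e" "0 \<le> l" "l \<le> 1" "norm (a - b) < d e"
  show "(SUP u\<in>K. u (l *\<^sub>R a + (1 - l) *\<^sub>R b))
     \<le> l * (SUP u\<in>K. u a) + (1 - l) * (SUP u\<in>K. u b) + l * (1 - l) * (e * norm (a - b))"
  proof (rule cSUP_least[OF assms(1)])
    fix u assume u: "u \<in> K"
    have "u (l *\<^sub>R a + (1 - l) *\<^sub>R b) \<le> l * u a + (1 - l) * u b + l * (1 - l) * (e * norm (a - b))"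
      by (rule almost_convexD[OF ac[OF u] h])
    moreover have "l * u a \<le> l * (SUP u\<in>K. u a)"
      using h cSUP_upper[OF u bdd[of a]] by (intro mult_left_mono) auto
    moreover have "(1 - l) * u b \<le> (1 - l) * (SUP u\<in>K. u b)"
      using h cSUP_upper[OF u bdd[of b]] by (intro mult_left_mono) auto
    ultimately show "u (l *\<^sub>R a + (1 - l) *\<^sub>R b)
       \<le> l * (SUP u\<in>K. u a) + (1 - l) * (SUP u\<in>K. u b) + l * (1 - l) * (e * norm (a - b))"
      by linarith
  qed
qed

lemma almost_convex_average:
  fixes u :: "'a::real_normed_vector \<Rightarrow> real"
  assumes ac: "almost_convex d u" and "0 \<le> m" "m \<le> (1::real)"
  shows "almost_convex d (\<lambda>z. m * u (z + p) + (1 - m) * u (z + q) - c)"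
  unfolding almost_convex_def
proof (intro allI impI)
  fix e l :: real and a b :: 'a
  assume h: "0 < e" "0 \<le> l" "l \<le> 1" "norm (a - b) < d e"
  have tr: "u (l *\<^sub>R a + (1 - l) *\<^sub>R b + p)
      \<le> l * u (a + p) + (1 - l) * u (b + p) + l * (1 - l) * (e * norm (a - b))" for p
  proof -
    have eq: "l *\<^sub>R a + (1 - l) *\<^sub>R b + p = l *\<^sub>R (a + p) + (1 - l) *\<^sub>R (b + p)"
      by (simp add: algebra_simps)
    show ?thesis
      unfolding eq using almost_convexD[OF ac h(1-3), of "a + p" "b + p"] h(4) by simp
  qed
  have "m * u (l *\<^sub>R a + (1 - l) *\<^sub>R b + p) + (1 - m) * u (l *\<^sub>R a + (1 - l) *\<^sub>R b + q)
     \<le> m * (l * u (a + p) + (1 - l) * u (b + p) + l * (1 - l) * (e * norm (a - b)))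
       + (1 - m) * (l * u (a + q) + (1 - l) * u (b + q) + l * (1 - l) * (e * norm (a - b)))"
    using assms(2,3) by (intro add_mono mult_left_mono tr) auto
  also have "\<dots> = l * (m * u (a + p) + (1 - m) * u (a + q))
       + (1 - l) * (m * u (b + p) + (1 - m) * u (b + q)) + l * (1 - l) * (e * norm (a - b))"
    by (simp add: algebra_simps)
  finally show "m * u (l *\<^sub>R a + (1 - l) *\<^sub>R b + p) + (1 - m) * u (l *\<^sub>R a + (1 - l) *\<^sub>R b + q) - c
     \<le> l * (m * u (a + p) + (1 - m) * u (a + q) - c)
       + (1 - l) * (m * u (b + p) + (1 - m) * u (b + q) - c) + l * (1 - l) * (e * norm (a - b))"
    by (simp add: algebra_simps)
qed

text \<open>
  The inserted function is the largest almost convex minorant of \<open>g2\<close>. It inherits almost concavity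
  from \<open>g2\<close> because the class of almost convex functions is invariant under averaging of translates.
\<close>
lemma almost_convex_concave_insertion:
  fixes g1 g2 :: "'a::real_normed_vector \<Rightarrow> real"
  assumes g1: "almost_convex d g1" and g2: "almost_convex d (\<lambda>x. - g2 x)"
    and le: "\<And>x. g1 x \<le> g2 x"
  obtains h where "\<And>x. g1 x \<le> h x" "\<And>x. h x \<le> g2 x"
    "almost_convex d h" "almost_convex d (\<lambda>x. - h x)"
proof -
  define K where "K = {u. almost_convex d u \<and> (\<forall>x. u x \<le> g2 x)}"
  define h where "h x = (SUP u\<in>K. u x)" for x
  have g1K: "g1 \<in> K" using g1 le by (simp add: K_def)
  have bdd: "bdd_above ((\<lambda>u. u x) ` K)" for x
    by (rule bdd_aboveI[of _ "g2 x"]) (auto simp: K_def)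
  have upper: "u x \<le> h x" if "u \<in> K" for u x
    unfolding h_def using that bdd by (rule cSUP_upper)
  have hle: "h x \<le> g2 x" for x
    unfolding h_def using g1K by (intro cSUP_least) (auto simp: K_def)
  have hc: "almost_convex d h"
    unfolding h_def using g1K bdd by (intro almost_convex_SUP) (auto simp: K_def)
  have "almost_convex d (\<lambda>x. - h x)"
    unfolding almost_convex_def
  proof (intro allI impI)
    fix e l :: real and a b :: 'a
    assume A: "0 < e" "0 \<le> l" "l \<le> 1" "norm (a - b) < d e"
    define z where "z = l *\<^sub>R a + (1 - l) *\<^sub>R b"
    \<comment> \<open>This average of translates of \<open>h\<close> competes in the supremum that defines \<open>h\<close>.\<close>
    define u where "u y = l * h (y + (a - z)) + (1 - l) * h (y + (b - z))
        - l * (1 - l) * (e * norm (a - b))" for y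
    have "u \<in> K"
      unfolding K_def
    proof (intro CollectI conjI allI)
      show "almost_convex d u"
        unfolding u_def using hc A by (intro almost_convex_average) auto
      fix y
      have nn: "y + (a - z) - (y + (b - z)) = a - b" by simp
      have yy: "l *\<^sub>R (y + (a - z)) + (1 - l) *\<^sub>R (y + (b - z)) = y"
        by (simp add: z_def algebra_simps)
      have "l * h (y + (a - z)) + (1 - l) * h (y + (b - z))
          \<le> l * g2 (y + (a - z)) + (1 - l) * g2 (y + (b - z))"
        using A by (intro add_mono mult_left_mono hle) auto
      moreover have "l * g2 (y + (a - z)) + (1 - l) * g2 (y + (b - z))
          \<le> g2 y + l * (1 - l) * (e * norm (a - b))"
        using almost_convexD[OF g2 A(1-3), of "y + (a - z)" "y + (b - z)"] A(4)
        unfolding nn yy by simp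
      ultimately show "u y \<le> g2 y" by (simp add: u_def)
    qed
    from upper[OF this, of z]
    show "- h (l *\<^sub>R a + (1 - l) *\<^sub>R b) \<le> l * - h a + (1 - l) * - h b + l * (1 - l) * (e * norm (a - b))"
      by (simp add: u_def flip: z_def)
  qed
  then show thesis using that[of h] upper[OF g1K] hle hc by blast
qed

section \<open>Functions that are semiconvex and semiconcave\<close>

lemma eq_0_if_abs_le_all_multiples:
  fixes x K :: real
  assumes "\<And>e. e > 0 \<Longrightarrow> \<bar>x\<bar> \<le> e * K"
  shows "x = 0"
proof (rule ccontr)
  assume x: "x \<noteq> 0"
  define e where "e = \<bar>x\<bar> / (2 * (\<bar>K\<bar> + 1))"
  have "e > 0" using x by (simp add: e_def)
  have "e * K \<le> e * (\<bar>K\<bar> + 1)" using \<open>e > 0\<close> by (intro mult_left_mono) auto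
  also have "\<dots> = \<bar>x\<bar> / 2" by (simp add: e_def field_simps)
  finally show False using assms[OF \<open>e > 0\<close>] x by simp
qed

lemma small_scale:
  fixes d :: real
  assumes "d > 0"
  obtains s where "0 < s" "s * K < d"
proof
  show "0 < d / (2 * (\<bar>K\<bar> + 1))" using assms by simp
  have "d / (2 * (\<bar>K\<bar> + 1)) * K \<le> d / (2 * (\<bar>K\<bar> + 1)) * (\<bar>K\<bar> + 1)"
    using assms by (intro mult_left_mono) auto
  also have "\<dots> = d / 2" by (simp add: field_simps)
  also have "\<dots> < d" using assms by simp
  finally show "d / (2 * (\<bar>K\<bar> + 1)) * K < d" .
qed

text \<open>
  A first-order expansion with an error that is uniform in the base point forces the derivative
  to be uniformly continuous: if \<open>\<parallel>x - y\<parallel>\<close> is less than \<open>\<parallel>v\<parallel>\<close>, then expanding the increment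
  \<open>h (y + v) - h y\<close> both at \<open>y\<close> and at \<open>x\<close> costs only a small multiple of \<open>\<parallel>v\<parallel>\<close>.
\<close>
lemma C1_plus_on_if_uniform_expansion:
  fixes h :: "'a::real_normed_vector \<Rightarrow> real" and D :: "'a \<Rightarrow> 'a \<Rightarrow>\<^sub>L real"
  assumes dpos: "\<And>e. e > 0 \<Longrightarrow> d e > 0"
    and est: "\<And>e x v. e > 0 \<Longrightarrow> norm v < d e \<Longrightarrow> \<bar>h (x + v) - h x - D x v\<bar> \<le> e * norm v"
  shows "C1_plus_on UNIV h"
  unfolding C1_plus_on_def
proof (intro exI[of _ D] conjI ballI)
  show "(h has_derivative blinfun_apply (D x)) (at x)" for x
    unfolding has_derivative_at_alt
  proof (intro conjI allI impI)
    show "bounded_linear (blinfun_apply (D x))" by (rule blinfun.bounded_linear_right)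
    fix e :: real assume "e > 0"
    then show "\<exists>\<delta>>0. \<forall>y. norm (y - x) < \<delta> \<longrightarrow>
        norm (h y - h x - blinfun_apply (D x) (y - x)) \<le> e * norm (y - x)"
      using dpos[of e] est[of e "_ - x" x] by (intro exI[of _ "d e"]) auto
  qed
  show "uniformly_continuous_on UNIV D"
    unfolding uniformly_continuous_on_def
  proof (intro allI impI)
    fix e :: real assume "e > 0"
    define e' where "e' = e / 8"
    have e': "e' > 0" using \<open>e > 0\<close> by (simp add: e'_def)
    \<comment> \<open>A third of the threshold, since below \<open>h\<close> is expanded at \<open>x\<close> along a vector of norm up to \<open>2 * r\<close>.\<close>
    define r where "r = d e' / 3"
    have r: "r > 0" "2 * r < d e'" using dpos[OF e'] by (auto simp: r_def)
    show "\<exists>\<delta>>0. \<forall>x\<in>UNIV. \<forall>x'\<in>UNIV. dist x' x < \<delta> \<longrightarrow> dist (D x') (D x) < e"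
    proof (intro exI[of _ r] conjI ballI impI)
      fix x y :: 'a assume "dist y x < r"
      then have yx: "norm (y - x) < r" by (simp add: dist_norm)
      have "norm ((D x - D y) w) \<le> 4 * e' * norm w" for w
      proof (cases "w = 0")
        case False
        define v where "v = (r / norm w) *\<^sub>R w"
        have nv: "norm v = r" using False r by (simp add: v_def)
        have nn: "norm (y + v - x) \<le> 2 * r"
          using norm_triangle_ineq[of "y - x" v] yx nv by (simp add: algebra_simps)
        have 1: "\<bar>h (y + v) - h x - D x (y + v - x)\<bar> \<le> e' * norm (y + v - x)"
          using est[OF e', of "y + v - x" x] nn r by simp
        have 2: "\<bar>h y - h x - D x (y - x)\<bar> \<le> e' * norm (y - x)"
          using est[OF e', of "y - x" x] yx r by simp
        have 3: "\<bar>h (y + v) - h y - D y v\<bar> \<le> e' * norm v"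
          using est[OF e', of v y] nv r by simp
        have "D x (y + v - x) = D x (y - x) + D x v"
          by (simp add: blinfun.bilinear_simps)
        with 1 2 3 have "\<bar>D x v - D y v\<bar> \<le> e' * norm (y + v - x) + e' * norm (y - x) + e' * norm v"
          by linarith
        also have "\<dots> \<le> e' * (2 * r) + e' * r + e' * r"
          using nn yx nv e' by (intro add_mono mult_left_mono) auto
        finally have "\<bar>(D x - D y) v\<bar> \<le> 4 * e' * r"
          by (simp add: blinfun.bilinear_simps)
        moreover have "(D x - D y) v = (r / norm w) * (D x - D y) w"
          by (simp add: v_def blinfun.bilinear_simps)
        ultimately show ?thesis
          using r False by (simp add: abs_mult field_simps)
      qed simp
      then have "norm (D x - D y) \<le> 4 * e'"
        using e' by (intro norm_blinfun_bound) auto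
      then show "dist (D y) (D x) < e"
        using \<open>e > 0\<close> by (simp add: dist_norm norm_minus_commute e'_def)
    qed (use r in auto)
  qed
qed

text \<open>
  The two-sided inequality with one endpoint at \<open>x\<close> says that the difference quotients at \<open>x\<close> in a direction
  \<open>v\<close> form a Cauchy family, uniformly in \<open>x\<close>; with \<open>l = 1/2\<close> and endpoints \<open>x + s v\<close>, \<open>x + s w\<close> it makes
  their limit additive. Local boundedness of \<open>h\<close> is what makes the limit a bounded functional.
\<close>
lemma C1_plus_on_if_almost_convex_concave:
  fixes h :: "'a::real_normed_vector \<Rightarrow> real"
  assumes cv: "almost_convex d h" and cc: "almost_convex d (\<lambda>x. - h x)"
    and dpos: "\<And>e. e > 0 \<Longrightarrow> d e > 0"
    and bdd: "\<And>x. \<exists>r>0. \<exists>B. \<forall>v. norm v < r \<longrightarrow> \<bar>h (x + v)\<bar> \<le> B"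
  shows "C1_plus_on UNIV h"
proof -
  have key: "\<bar>l * h a + (1 - l) * h b - h (l *\<^sub>R a + (1 - l) *\<^sub>R b)\<bar> \<le> l * (1 - l) * (e * norm (a - b))"
    if "e > 0" "0 \<le> l" "l \<le> 1" "norm (a - b) < d e" for e l a b
    using almost_convexD[OF cv that] almost_convexD[OF cc that] by (simp add: abs_le_iff)
  define q where "q x v t = (h (x + t *\<^sub>R v) - h x) / t" for x v and t :: real
  have q_close: "\<bar>q x v s - q x v t\<bar> \<le> e * norm v"
    if "e > 0" "0 < t" "t \<le> s" "s * norm v < d e" for e x v s t
  proof -
    have s: "s > 0" using that by simp
    define l where "l = t / s"
    have l: "0 < l" "l \<le> 1" "l * s = t" using that s by (auto simp: l_def)
    have "l *\<^sub>R (x + s *\<^sub>R v) + (1 - l) *\<^sub>R x = x + (l * s) *\<^sub>R v"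
      by (simp add: algebra_simps)
    with key[of e l "x + s *\<^sub>R v" x] that l s
    have "\<bar>l * h (x + s *\<^sub>R v) + (1 - l) * h x - h (x + t *\<^sub>R v)\<bar> \<le> l * (1 - l) * (e * (s * norm v))"
      by simp
    also have "\<dots> \<le> l * 1 * (e * (s * norm v))"
      using l that s by (intro mult_right_mono mult_left_mono) auto
    also have "\<dots> = t * (e * norm v)" using l(3) by (simp add: algebra_simps)
    also have "l * h (x + s *\<^sub>R v) + (1 - l) * h x - h (x + t *\<^sub>R v) = t * (q x v s - q x v t)"
      using s that(2) by (simp add: q_def l_def field_simps)
    finally show ?thesis using that(2) by (simp add: abs_mult)
  qed
  have "\<exists>D. (\<lambda>n. q x v (inverse (real (Suc n)))) \<longlonglongrightarrow> D" for x v
  proof -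
    have "Cauchy (\<lambda>n. q x v (inverse (real (Suc n))))"
    proof (rule metric_CauchyI)
      fix e :: real assume "e > 0"
      obtain e' where e': "0 < e'" "e' * norm v < e / 2"
        using small_scale[of "e / 2" "norm v"] \<open>e > 0\<close> by auto
      obtain s where s: "0 < s" "s * norm v < d e'"
        using small_scale[OF dpos[OF e'(1)]] by blast
      obtain N where N: "inverse (real (Suc N)) < s" using reals_Archimedean[OF s(1)] by blast
      have "dist (q x v s) (q x v (inverse (real (Suc n)))) < e / 2" if "n \<ge> N" for n
      proof -
        have "inverse (real (Suc n)) \<le> s"
          using N that by (smt (verit) inverse_le_iff_le of_nat_0_less_iff of_nat_le_iff Suc_le_mono zero_less_Suc)
        then show ?thesis
          using q_close[of e' "inverse (real (Suc n))" s v x] e' s by (simp add: dist_real_def)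
      qed
      then show "\<exists>M. \<forall>m\<ge>M. \<forall>n\<ge>M. dist (q x v (inverse (real (Suc m)))) (q x v (inverse (real (Suc n)))) < e"
        by (meson dist_triangle_half_r)
    qed
    then show ?thesis using Cauchy_convergent_iff convergent_def by blast
  qed
  then obtain D where D: "\<And>x v. (\<lambda>n. q x v (inverse (real (Suc n)))) \<longlonglongrightarrow> D x v"
    by metis
  have qD: "\<bar>q x v s - D x v\<bar> \<le> e * norm v" if "e > 0" "0 < s" "s * norm v < d e" for e s x v
  proof -
    have "(\<lambda>n. \<bar>q x v s - q x v (inverse (real (Suc n)))\<bar>) \<longlonglongrightarrow> \<bar>q x v s - D x v\<bar>"
      by (intro tendsto_intros D)
    moreover have "eventually (\<lambda>n. inverse (real (Suc n)) < s) sequentially"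
      using order_tendstoD(2)[OF LIMSEQ_inverse_real_of_nat that(2)] .
    then have "eventually (\<lambda>n. \<bar>q x v s - q x v (inverse (real (Suc n)))\<bar> \<le> e * norm v) sequentially"
      by eventually_elim (use that in \<open>auto intro!: q_close\<close>)
    ultimately show ?thesis by (rule tendsto_upperbound) simp
  qed
  have est: "\<bar>h (x + v) - h x - D x v\<bar> \<le> e * norm v" if "e > 0" "norm v < d e" for e x v
    using qD[of e 1 v x] that by (simp add: q_def)
  have pos_scale: "D x (c *\<^sub>R v) = c * D x v" if c: "c > 0" for x c v
  proof -
    have "D x (c *\<^sub>R v) - c * D x v = 0"
    proof (rule eq_0_if_abs_le_all_multiples)
      fix e :: real assume e: "e > 0"
      obtain s where s: "0 < s" "s * norm (c *\<^sub>R v) < d e" using small_scale[OF dpos[OF e]] by blast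
      have 1: "\<bar>q x (c *\<^sub>R v) s - D x (c *\<^sub>R v)\<bar> \<le> e * norm (c *\<^sub>R v)" using qD[OF e s] .
      have 2: "\<bar>q x v (s * c) - D x v\<bar> \<le> e * norm v"
        using qD[of e "s * c" v x] e s c by (simp add: mult.assoc)
      have "q x (c *\<^sub>R v) s = c * q x v (s * c)" using c s by (simp add: q_def)
      then have "\<bar>D x (c *\<^sub>R v) - c * D x v\<bar> = \<bar>c * (q x v (s * c) - D x v) - (q x (c *\<^sub>R v) s - D x (c *\<^sub>R v))\<bar>"
        by (simp add: algebra_simps)
      also have "\<dots> \<le> \<bar>c * (q x v (s * c) - D x v)\<bar> + \<bar>q x (c *\<^sub>R v) s - D x (c *\<^sub>R v)\<bar>"
        by (rule abs_triangle_ineq4)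
      also have "\<dots> \<le> c * (e * norm v) + e * norm (c *\<^sub>R v)"
        using c 2 by (intro add_mono 1) (simp add: abs_mult)
      also have "\<dots> = e * (2 * c * norm v)" using c by simp
      finally show "\<bar>D x (c *\<^sub>R v) - c * D x v\<bar> \<le> e * (2 * c * norm v)" .
    qed
    then show ?thesis by simp
  qed
  have add: "D x (v + w) = D x v + D x w" for x v w
  proof -
    have "D x v + D x w - D x (v + w) = 0"
    proof (rule eq_0_if_abs_le_all_multiples)
      fix e :: real assume e: "e > 0"
      obtain s where s: "0 < s" "s * (norm v + norm w) < d e" using small_scale[OF dpos[OF e]] by blast
      define t where "t = s / 2"
      have t: "t > 0" "2 * t = s" using s by (auto simp: t_def)
      have bnd: "s * norm u < d e" if "norm u \<le> norm v + norm w" for u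
        using mult_left_mono[OF that, of s] s by linarith
      have bnd': "s * norm (v - w) < d e" by (intro bnd norm_triangle_ineq4)
      have "t * norm (v + w) \<le> s * norm (v + w)" using t by (intro mult_right_mono) auto
      then have 3: "\<bar>q x (v + w) t - D x (v + w)\<bar> \<le> e * norm (v + w)"
        using bnd[of "v + w"] norm_triangle_ineq[of v w] by (intro qD e t) auto
      have 1: "\<bar>q x v s - D x v\<bar> \<le> e * norm v" by (intro qD e s bnd) auto
      have 2: "\<bar>q x w s - D x w\<bar> \<le> e * norm w" by (intro qD e s bnd) auto
      have eq: "(1/2) *\<^sub>R (x + s *\<^sub>R v) + (1 - 1/2) *\<^sub>R (x + s *\<^sub>R w) = x + t *\<^sub>R (v + w)"
      proof -
        have "x = (1/2) *\<^sub>R x + (1/2) *\<^sub>R x" by (metis scaleR_half_double scaleR_add_right)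
        then show ?thesis by (simp add: t_def algebra_simps)
      qed
      have "x + s *\<^sub>R v - (x + s *\<^sub>R w) = s *\<^sub>R (v - w)" by (simp add: algebra_simps)
      then have nrm: "norm (x + s *\<^sub>R v - (x + s *\<^sub>R w)) = s * norm (v - w)" using s by simp
      have "\<bar>(1/2) * h (x + s *\<^sub>R v) + (1 - 1/2) * h (x + s *\<^sub>R w) - h (x + t *\<^sub>R (v + w))\<bar>
          \<le> (1/2) * (1 - 1/2) * (e * (s * norm (v - w)))"
        using key[OF e, of "1/2" "x + s *\<^sub>R v" "x + s *\<^sub>R w"] bnd'
        unfolding eq nrm by simp
      also have "(1/2) * h (x + s *\<^sub>R v) + (1 - 1/2) * h (x + s *\<^sub>R w) - h (x + t *\<^sub>R (v + w))
          = t * (q x v s + q x w s - q x (v + w) t)"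
        using s t by (simp add: q_def t_def field_simps)
      also have "(1/2) * (1 - 1/2) * (e * (s * norm (v - w))) = t * (e * norm (v - w) / 2)"
        by (simp add: t_def)
      finally have "\<bar>q x v s + q x w s - q x (v + w) t\<bar> \<le> e * norm (v - w) / 2"
        using t by (simp add: abs_mult)
      also have "\<dots> \<le> e * norm (v - w)" using e by simp
      finally have "\<bar>D x v + D x w - D x (v + w)\<bar>
          \<le> e * norm v + e * norm w + e * norm (v + w) + e * norm (v - w)"
        using 1 2 3 by linarith
      then show "\<bar>D x v + D x w - D x (v + w)\<bar> \<le> e * (norm v + norm w + norm (v + w) + norm (v - w))"
        by (simp add: algebra_simps)
    qed
    then show ?thesis by simp
  qed
  have D0: "D x 0 = 0" for x using add[of x 0 0] by simp
  have neg: "D x (- v) = - D x v" for x v using add[of x v "- v"] D0 by simp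
  have scale: "D x (c *\<^sub>R v) = c *\<^sub>R D x v" for x c v
  proof (cases "c = 0")
    case False
    then consider "c > 0" | "- c > 0" by linarith
    then show ?thesis
    proof cases
      case 2 then show ?thesis using pos_scale[of "- c" x v] neg[of x "c *\<^sub>R v"] by simp
    qed (simp add: pos_scale)
  qed (simp add: D0)
  have bl: "bounded_linear (D x)" for x
  proof -
    obtain r B where r: "r > 0" and B: "\<And>v. norm v < r \<Longrightarrow> \<bar>h (x + v)\<bar> \<le> B" using bdd[of x] by blast
    define s where "s = min r (d 1) / 2"
    have s: "0 < s" "s < r" "s < d 1" using r dpos[of 1] by (auto simp: s_def)
    have "norm (D x v) \<le> norm v * ((2 * B + s) / s)" for v
    proof (cases "v = 0")
      case False
      define u where "u = (s / norm v) *\<^sub>R v"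
      have nu: "norm u = s" using False s by (simp add: u_def)
      have "\<bar>D x u\<bar> \<le> 2 * B + s"
        using est[of 1 u x] nu s B[of u] B[of 0] r by simp
      moreover have "D x u = s / norm v * D x v" by (simp add: u_def scale)
      ultimately show ?thesis using s False by (simp add: abs_mult field_simps)
    qed (simp add: D0)
    with add scale show ?thesis by (intro bounded_linear_intro[of _ "(2 * B + s) / s"]) auto
  qed
  show ?thesis
    by (rule C1_plus_on_if_uniform_expansion[of d h "\<lambda>x. Blinfun (D x)"])
       (simp_all add: dpos est bounded_linear_Blinfun_apply bl)
qed

section \<open>Convex functions with uniformly small second differences\<close>

definition uniformly_small_second_differences :: "('a::real_normed_vector \<Rightarrow> real) \<Rightarrow> bool" where
  "uniformly_small_second_differences g \<longleftrightarrow>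
     (\<forall>e>0. \<exists>d>0. \<forall>z v. norm v < d \<longrightarrow> g (z + v) + g (z - v) - 2 * g z \<le> e * norm v)"

lemma uniformly_small_second_differencesE:
  assumes "uniformly_small_second_differences g" "e > 0"
  obtains d where "d > 0"
    "\<And>z v. norm v < d \<Longrightarrow> g (z + v) + g (z - v) - 2 * g z \<le> e * norm v"
  using assms unfolding uniformly_small_second_differences_def by blast

text \<open>
  For a convex function the midpoint condition is enough. On the segment from \<open>z - v\<close> to \<open>z + v\<close> the chord
  slopes are monotone, so the defect of concavity at an intermediate position \<open>l\<close> is at
  most \<open>l * (1 - l)\<close> times the symmetric second difference at \<open>z\<close>.
\<close>
lemma almost_convex_uminus_if_convex:
  fixes g :: "'a::real_normed_vector \<Rightarrow> real"
  assumes cvx: "convex_on UNIV g" and sd: "uniformly_small_second_differences g"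
  obtains d where "\<And>e. e > 0 \<Longrightarrow> d e > 0" "almost_convex d (\<lambda>x. - g x)"
proof -
  obtain d where dpos: "\<And>e. e > 0 \<Longrightarrow> d e > 0"
    and d: "\<And>e z v. e > 0 \<Longrightarrow> norm v < d e \<Longrightarrow> g (z + v) + g (z - v) - 2 * g z \<le> e * norm v"
    using sd unfolding uniformly_small_second_differences_def by metis
  have "almost_convex d (\<lambda>x. - g x)"
    unfolding almost_convex_def
  proof (intro allI impI)
    fix e l :: real and a b :: 'a
    assume A: "0 < e" "0 \<le> l" "l \<le> 1" "norm (a - b) < d e"
    define v where "v = a - b"
    define z where "z = l *\<^sub>R a + (1 - l) *\<^sub>R b"
    have a: "a = (1 - l) *\<^sub>R (z + v) + l *\<^sub>R z" by (simp add: z_def v_def algebra_simps)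
    have b: "b = (1 - l) *\<^sub>R z + l *\<^sub>R (z - v)" by (simp add: z_def v_def algebra_simps)
    have "g a \<le> (1 - l) * g (z + v) + l * g z"
      by (subst a, rule convex_onD[OF cvx]) (use A in auto)
    moreover have "g b \<le> (1 - l) * g z + l * g (z - v)"
      by (subst b, rule convex_onD[OF cvx]) (use A in auto)
    ultimately have "l * g a + (1 - l) * g b
       \<le> l * ((1 - l) * g (z + v) + l * g z) + (1 - l) * ((1 - l) * g z + l * g (z - v))"
      using A by (intro add_mono mult_left_mono) auto
    also have "\<dots> = g z + l * (1 - l) * (g (z + v) + g (z - v) - 2 * g z)"
      by (simp add: algebra_simps)
    also have "\<dots> \<le> g z + l * (1 - l) * (e * norm v)"
      using A d[of e v z] by (intro add_left_mono mult_left_mono) (auto simp: v_def)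
    finally show "- g (l *\<^sub>R a + (1 - l) *\<^sub>R b) \<le> l * - g a + (1 - l) * - g b + l * (1 - l) * (e * norm (a - b))"
      by (simp add: z_def v_def)
  qed
  with dpos that show thesis by blast
qed

lemma uniformly_small_second_differences_add:
  assumes "uniformly_small_second_differences g" "uniformly_small_second_differences h"
  shows "uniformly_small_second_differences (\<lambda>x. g x + h x)"
  unfolding uniformly_small_second_differences_def
proof (intro allI impI)
  fix e :: real assume "e > 0"
  then have "e / 2 > 0" by simp
  obtain d where d: "d > 0" "\<And>z v. norm v < d \<Longrightarrow> g (z + v) + g (z - v) - 2 * g z \<le> e / 2 * norm v"
    using uniformly_small_second_differencesE[OF assms(1) \<open>e / 2 > 0\<close>] by blast
  obtain d' where d': "d' > 0" "\<And>z v. norm v < d' \<Longrightarrow> h (z + v) + h (z - v) - 2 * h z \<le> e / 2 * norm v"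
    using uniformly_small_second_differencesE[OF assms(2) \<open>e / 2 > 0\<close>] by blast
  have "g (z + v) + h (z + v) + (g (z - v) + h (z - v)) - 2 * (g z + h z) \<le> e * norm v"
    if "norm v < min d d'" for z v
    using d(2)[of v z] d'(2)[of v z] that by simp
  then show "\<exists>d>0. \<forall>z v. norm v < d \<longrightarrow>
      g (z + v) + h (z + v) + (g (z - v) + h (z - v)) - 2 * (g z + h z) \<le> e * norm v"
    using d(1) d'(1) by (intro exI[of _ "min d d'"]) auto
qed

text \<open>
  The bound by \<open>c k\<close> takes care of the tail of the series uniformly; the finitely many remaining terms
  are small at a common scale.
\<close>
lemma uniformly_small_second_differences_suminf:
  fixes g :: "nat \<Rightarrow> 'a::real_normed_vector \<Rightarrow> real"
  assumes sd: "\<And>k. uniformly_small_second_differences (g k)"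
    and bound: "\<And>k z v. g k (z + v) + g k (z - v) - 2 * g k z \<le> c k * norm v"
    and c: "summable c" and g: "\<And>x. summable (\<lambda>k. g k x)"
  shows "uniformly_small_second_differences (\<lambda>x. \<Sum>k. g k x)"
  unfolding uniformly_small_second_differences_def
proof (intro allI impI)
  fix e :: real assume "e > 0"
  obtain K where K: "\<bar>\<Sum>k. c (k + K)\<bar> < e / 2"
    using suminf_exist_split[OF _ c, of "e / 2"] \<open>e > 0\<close> by auto
  have part: "uniformly_small_second_differences (\<lambda>x. \<Sum>k<n. g k x)" for n
  proof (induction n)
    case 0
    show ?case
      unfolding uniformly_small_second_differences_def by (auto intro!: exI[of _ 1])
  next
    case (Suc n)
    then show ?case by (simp add: uniformly_small_second_differences_add sd)
  qed
  obtain d where d: "d > 0" "\<And>z v. norm v < d \<Longrightarrow>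
      (\<Sum>k<K. g k (z + v)) + (\<Sum>k<K. g k (z - v)) - 2 * (\<Sum>k<K. g k z) \<le> e / 2 * norm v"
    using uniformly_small_second_differencesE[OF part[of K], of "e / 2"] \<open>e > 0\<close> by auto
  have "(\<Sum>k. g k (z + v)) + (\<Sum>k. g k (z - v)) - 2 * (\<Sum>k. g k z) \<le> e * norm v"
    if v: "norm v < d" for z v
  proof -
    have s: "summable (\<lambda>k. g (k + K) x)" for x using summable_ignore_initial_segment[OF g] .
    have split: "(\<Sum>k. g k x) = (\<Sum>k. g (k + K) x) + (\<Sum>k<K. g k x)" for x
      by (rule suminf_split_initial_segment[OF g])
    have "(\<Sum>k. g (k + K) (z + v)) + (\<Sum>k. g (k + K) (z - v)) - 2 * (\<Sum>k. g (k + K) z)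
        = (\<Sum>k. g (k + K) (z + v) + g (k + K) (z - v) - 2 * g (k + K) z)"
      by (simp add: suminf_add s suminf_mult[OF s, symmetric]
          suminf_diff[OF summable_add[OF s s] summable_mult[OF s]])
    also have "\<dots> \<le> (\<Sum>k. c (k + K) * norm v)"
      by (intro suminf_le bound summable_diff summable_add summable_mult summable_mult2 s
          summable_ignore_initial_segment[OF c])
    also have "\<dots> = (\<Sum>k. c (k + K)) * norm v"
      by (rule suminf_mult2[symmetric]) (rule summable_ignore_initial_segment[OF c])
    also have "\<dots> \<le> e / 2 * norm v" using K by (intro mult_right_mono) auto
    finally show ?thesis
      using d(2)[OF v, of z] unfolding split by (simp add: algebra_simps)
  qed
  with d(1) show "\<exists>d>0. \<forall>z v. norm v < d \<longrightarrow>
      (\<Sum>k. g k (z + v)) + (\<Sum>k. g k (z - v)) - 2 * (\<Sum>k. g k z) \<le> e * norm v" by blast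
qed

section \<open>A gauge built from a uniformly smooth norm\<close>

text \<open>
  The profile behaves like \<open>s\<^sup>2 / b\<close> below the scale \<open>b\<close> and like \<open>s\<close> above it. The first property removes
  the singularity of a norm at the origin, the second one lets a weighted sum over scales dominate
  \<open>s\<close> times a given modulus.
\<close>
definition profile :: "real \<Rightarrow> real \<Rightarrow> real" where
  "profile b s = s\<^sup>2 / (b + s)"

text \<open>The derivative of the profile at \<open>r\<close>.\<close>
definition profile_slope :: "real \<Rightarrow> real \<Rightarrow> real" where
  "profile_slope b r = 1 - (b / (b + r))\<^sup>2"

text \<open>
  The exact remainder of the tangent line. That it is nonnegative gives convexity, and that it is at most
  \<open>(p - r)\<^sup>2 / b\<close> gives smoothness.
\<close>
lemma profile_expansion:
  assumes "b > 0" "p \<ge> 0" "r \<ge> 0"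
  shows "profile b p = profile b r + profile_slope b r * (p - r) + b\<^sup>2 * (p - r)\<^sup>2 / ((b + p) * (b + r)\<^sup>2)"
proof -
  have ne: "b + p \<noteq> 0" "b + r \<noteq> 0" using assms by auto
  define P R where "P = b + p" and "R = b + r"
  have pr: "p = P - b" "r = R - b" by (simp_all add: P_def R_def)
  have "P \<noteq> 0" "R \<noteq> 0" using ne by (simp_all add: P_def R_def)
  then show ?thesis
    unfolding profile_def profile_slope_def pr
    by (simp add: field_simps power2_eq_square)
qed

lemma profile_slope_bounds:
  assumes "b > 0" "r \<ge> 0"
  shows "0 \<le> profile_slope b r" "profile_slope b r \<le> 1" "profile_slope b r \<le> 2 * r / b"
proof -
  have "0 \<le> b / (b + r)" "b / (b + r) \<le> 1" using assms by auto
  then show "0 \<le> profile_slope b r" by (simp add: profile_slope_def power_le_one)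
  show "profile_slope b r \<le> 1" by (simp add: profile_slope_def)
  have "1 - (b / (b + r))\<^sup>2 \<le> 2 * (1 - b / (b + r))"
    using sum_squares_ge_zero[of "1 - b / (b + r)" 0] by (simp add: power2_eq_square algebra_simps)
  also have "1 - b / (b + r) = r / (b + r)" using assms by (simp add: field_simps)
  also have "2 * (r / (b + r)) \<le> 2 * r / b" using assms by (simp add: frac_le)
  finally show "profile_slope b r \<le> 2 * r / b" by (simp add: profile_slope_def)
qed

lemma profile_ge_tangent:
  assumes "b > 0" "p \<ge> 0" "r \<ge> 0"
  shows "profile b r + profile_slope b r * (p - r) \<le> profile b p"
  using assms by (simp add: profile_expansion[OF assms])

lemma profile_le_tangent:
  assumes "b > 0" "p \<ge> 0" "r \<ge> 0"
  shows "profile b p \<le> profile b r + profile_slope b r * (p - r) + (p - r)\<^sup>2 / b"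
proof -
  have "b * b\<^sup>2 \<le> (b + p) * (b + r)\<^sup>2"
    using assms by (intro mult_mono power_mono) auto
  then have "b\<^sup>2 / ((b + p) * (b + r)\<^sup>2) \<le> 1 / b"
    using assms by (simp add: divide_le_eq le_divide_eq add_pos_nonneg mult.commute)
  from mult_right_mono[OF this, of "(p - r)\<^sup>2"] show ?thesis
    by (simp add: profile_expansion[OF assms])
qed

lemma profile_diff_le:
  assumes "b > 0" "p \<ge> 0" "r \<ge> 0"
  shows "profile b p - profile b r \<le> \<bar>p - r\<bar>"
proof -
  have "profile b p - profile b r \<le> profile_slope b p * (p - r)"
    using profile_ge_tangent[of b r p] assms by (simp add: algebra_simps)
  also have "\<dots> \<le> profile_slope b p * \<bar>p - r\<bar>"
    using profile_slope_bounds[of b p] assms by (intro mult_left_mono) auto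
  also have "\<dots> \<le> 1 * \<bar>p - r\<bar>"
    using profile_slope_bounds[of b p] assms by (intro mult_right_mono) auto
  finally show ?thesis by simp
qed

locale uniformly_smooth_norm =
  fixes N :: "'a::real_normed_vector \<Rightarrow> real" and \<alpha> \<beta> :: real
  assumes nonneg: "0 \<le> N x"
    and triangle: "N (x + y) \<le> N x + N y"
    and scale: "N (c *\<^sub>R x) = \<bar>c\<bar> * N x"
    and pos: "0 < \<alpha>" "0 < \<beta>"
    and lower: "\<alpha> * norm x \<le> N x" and upper: "N x \<le> \<beta> * norm x"
    and smooth: "uniformly_smooth N"
begin

lemma zero: "N 0 = 0" using scale[of 0 0] by simp

lemma minus: "N (- x) = N x" using scale[of "-1" x] by simp

lemma eq_0_D: "N x = 0 \<Longrightarrow> x = 0"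
  using lower[of x] pos by (simp add: mult_le_0_iff)

lemma abs_diff_le: "\<bar>N (z + v) - N z\<bar> \<le> N v"
  using triangle[of z v] triangle[of "z + v" "- v"] by (simp add: minus)

lemma abs_diff_le': "\<bar>N (z - v) - N z\<bar> \<le> N v"
  using abs_diff_le[of z "- v"] by (simp add: minus)

text \<open>
  Uniform smoothness concerns unit vectors; by homogeneity it bounds second differences at \<open>z\<close> for
  increments that are small relative to \<open>N z\<close>.
\<close>
lemma second_difference_le:
  assumes "e > 0"
  obtains \<delta> where "\<delta> > 0" "\<And>z v. N v < \<delta> * N z \<Longrightarrow> N (z + v) + N (z - v) - 2 * N z \<le> e * N v"
proof -
  have e: "e / 2 > 0" using assms by simp
  obtain \<delta> where \<delta>: "\<delta> > 0" and sm: "\<And>t x y. 0 < t \<Longrightarrow> t < \<delta> \<Longrightarrow> N x = 1 \<Longrightarrow> N y = 1 \<Longrightarrow>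
      (N (x + t *\<^sub>R y) + N (x - t *\<^sub>R y)) / 2 - 1 \<le> e / 2 * t"
    using smooth e unfolding uniformly_smooth_def by meson
  have "N (z + v) + N (z - v) - 2 * N z \<le> e * N v" if *: "N v < \<delta> * N z" for z v
  proof (cases "N v = 0")
    case True then show ?thesis using eq_0_D[OF True] by (simp add: zero)
  next
    case False
    define r s where "r = N z" and "s = N v"
    have s: "s > 0" using False nonneg[of v] by (simp add: s_def)
    have r: "r > 0" using * nonneg[of z] nonneg[of v] by (cases "N z = 0") (auto simp: r_def)
    have eqs: "z + v = r *\<^sub>R (z /\<^sub>R r + (s / r) *\<^sub>R (v /\<^sub>R s))"
      "z - v = r *\<^sub>R (z /\<^sub>R r - (s / r) *\<^sub>R (v /\<^sub>R s))"
      using r s by (simp_all add: algebra_simps)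
    have "(N (z /\<^sub>R r + (s / r) *\<^sub>R (v /\<^sub>R s)) + N (z /\<^sub>R r - (s / r) *\<^sub>R (v /\<^sub>R s))) / 2 - 1 \<le> e / 2 * (s / r)"
    proof (rule sm)
      show "s / r < \<delta>" using * r by (simp add: r_def s_def field_simps)
      show "N (z /\<^sub>R r) = 1" using r by (simp add: scale flip: r_def)
      show "N (v /\<^sub>R s) = 1" using s by (simp add: scale flip: s_def)
    qed (use r s in auto)
    from mult_left_mono[OF this, of "2 * r"] r
    have "r * N (z /\<^sub>R r + (s / r) *\<^sub>R (v /\<^sub>R s)) + r * N (z /\<^sub>R r - (s / r) *\<^sub>R (v /\<^sub>R s)) - 2 * r \<le> e * s"
      by (simp add: field_simps)
    moreover have "N (z + v) = r * N (z /\<^sub>R r + (s / r) *\<^sub>R (v /\<^sub>R s))"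
      "N (z - v) = r * N (z /\<^sub>R r - (s / r) *\<^sub>R (v /\<^sub>R s))"
      using r by (simp_all only: eqs scale)
    ultimately show ?thesis by (simp add: r_def s_def)
  qed
  with \<delta> that show thesis by blast
qed

lemma convex_profile:
  assumes b: "b > 0"
  shows "convex_on UNIV (\<lambda>x. profile b (N x))"
proof (rule convex_onI)
  fix t :: real and x y :: 'a
  assume t: "0 < t" "t < 1"
  define z where "z = (1 - t) *\<^sub>R x + t *\<^sub>R y"
  define c where "c = profile_slope b (N z)"
  have c: "c \<ge> 0" using profile_slope_bounds[OF b nonneg] by (simp add: c_def)
  have "N z \<le> (1 - t) * N x + t * N y"
    using triangle[of "(1 - t) *\<^sub>R x" "t *\<^sub>R y"] t by (simp add: z_def scale)
  then have "0 \<le> c * ((1 - t) * N x + t * N y - N z)" using c by simp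
  moreover have "(1 - t) * (profile b (N z) + c * (N x - N z)) \<le> (1 - t) * profile b (N x)"
    unfolding c_def using t b by (intro mult_left_mono profile_ge_tangent nonneg) auto
  moreover have "t * (profile b (N z) + c * (N y - N z)) \<le> t * profile b (N y)"
    unfolding c_def using t b by (intro mult_left_mono profile_ge_tangent nonneg) auto
  ultimately have "profile b (N z) \<le> (1 - t) * profile b (N x) + t * profile b (N y)"
    by (simp add: algebra_simps)
  then show "profile b (N ((1 - t) *\<^sub>R x + t *\<^sub>R y)) \<le> (1 - t) * profile b (N x) + t * profile b (N y)"
    by (simp add: z_def)
qed simp

lemma profile_second_difference_le:
  assumes b: "b > 0"
  shows "profile b (N (z + v)) + profile b (N (z - v)) - 2 * profile b (N z) \<le> 2 * \<beta> * norm v"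
  using profile_diff_le[OF b nonneg nonneg, of "z + v" z] profile_diff_le[OF b nonneg nonneg, of "z - v" z]
    abs_diff_le[of z v] abs_diff_le'[of z v] upper[of v] by linarith

text \<open>
  At distances from the origin that are large compared with the increment, the uniform smoothness of \<open>N\<close> gives
  the bound. At the other points the slope of the profile is small, which compensates
  for the corner of \<open>N\<close> at the origin.
\<close>
lemma profile_uniformly_small_second_differences:
  assumes b: "b > 0"
  shows "uniformly_small_second_differences (\<lambda>x. profile b (N x))"
  unfolding uniformly_small_second_differences_def
proof (intro allI impI)
  fix e0 :: real assume "e0 > 0"
  define e where "e = e0 / \<beta>"
  have e: "e > 0" "e * \<beta> = e0" using pos \<open>e0 > 0\<close> by (auto simp: e_def)
  obtain \<delta> where \<delta>: "\<delta> > 0"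
    and sm: "\<And>z v. N v < \<delta> * N z \<Longrightarrow> N (z + v) + N (z - v) - 2 * N z \<le> e / 2 * N v"
    using second_difference_le[of "e / 2"] e by auto
  define K where "K = 2 / b + 4 / (b * \<delta>)"
  have K: "K > 0" using b \<delta> by (simp add: K_def add_pos_pos)
  define \<rho> where "\<rho> = e / (2 * K * \<beta>)"
  have \<rho>: "\<rho> > 0" using e K pos by (simp add: \<rho>_def)
  have "profile b (N (z + v)) + profile b (N (z - v)) - 2 * profile b (N z) \<le> e0 * norm v"
    if v: "norm v < \<rho>" for z v
  proof -
    define p q r s c where "p = N (z + v)" and "q = N (z - v)" and "r = N z" and "s = N v"
      and "c = profile_slope b r"
    note defs = p_def q_def r_def s_def
    have nn: "0 \<le> p" "0 \<le> q" "0 \<le> r" "0 \<le> s" by (simp_all add: defs nonneg)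
    have c: "0 \<le> c" "c \<le> 1" "c \<le> 2 * r / b"
      using profile_slope_bounds[OF b nn(3)] by (simp_all add: c_def)
    have diffs: "\<bar>p - r\<bar> \<le> s" "\<bar>q - r\<bar> \<le> s"
      unfolding defs by (rule abs_diff_le abs_diff_le')+
    have Ks: "K * s \<le> e / 2"
    proof -
      have "s \<le> \<beta> * \<rho>" using upper[of v] v pos by (simp add: s_def) (smt (verit) mult_left_mono)
      then have "K * s \<le> K * (\<beta> * \<rho>)" using K by simp
      also have "\<dots> = e / 2" using K pos by (simp add: \<rho>_def)
      finally show ?thesis .
    qed
    have sq: "(p - r)\<^sup>2 \<le> s\<^sup>2" "(q - r)\<^sup>2 \<le> s\<^sup>2"
      using diffs nn by (simp_all add: abs_le_square_iff[symmetric])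
    have "profile b p + profile b q - 2 * profile b r \<le> c * (p + q - 2 * r) + ((p - r)\<^sup>2 / b + (q - r)\<^sup>2 / b)"
      using profile_le_tangent[OF b nn(1,3)] profile_le_tangent[OF b nn(2,3)]
      by (simp add: c_def algebra_simps)
    also have "(p - r)\<^sup>2 / b + (q - r)\<^sup>2 / b \<le> s\<^sup>2 / b + s\<^sup>2 / b"
      using sq b by (intro add_mono divide_right_mono) auto
    finally have main: "profile b p + profile b q - 2 * profile b r \<le> c * (p + q - 2 * r) + 2 / b * s * s"
      by (simp add: power2_eq_square)
    have "c * (p + q - 2 * r) \<le> e / 2 * s + 4 / (b * \<delta>) * s * s"
    proof (cases "s < \<delta> * r")
      case True
      \<comment> \<open>Far from the origin, at the scale of \<open>v\<close>, uniform smoothness of \<open>N\<close> applies.\<close>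
      then have "p + q - 2 * r \<le> e / 2 * s" unfolding defs by (rule sm)
      then have "c * (p + q - 2 * r) \<le> c * (e / 2 * s)" using c by (intro mult_left_mono)
      also have "\<dots> \<le> 1 * (e / 2 * s)" using c nn e by (intro mult_right_mono) auto
      finally show ?thesis using b \<delta> nn by (smt (verit) divide_nonneg_pos mult_nonneg_nonneg mult_pos_pos)
    next
      case False
      \<comment> \<open>Close to the origin, the slope of the profile is small.\<close>
      then have "r \<le> s / \<delta>" using \<delta> by (simp add: field_simps)
      then have "2 * r / b \<le> 2 * (s / \<delta>) / b" using b by (intro divide_right_mono mult_left_mono) auto
      then have "c \<le> 2 * (s / \<delta>) / b" using c by linarith
      then have "c * (2 * s) \<le> 2 * (s / \<delta>) / b * (2 * s)" using nn by (intro mult_right_mono) auto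
      moreover have "c * (p + q - 2 * r) \<le> c * (2 * s)" using c diffs by (intro mult_left_mono) auto
      moreover have "2 * (s / \<delta>) / b * (2 * s) = 4 / (b * \<delta>) * s * s"
        by (simp add: mult_ac)
      moreover have "e / 2 * s \<ge> 0" using e nn by simp
      ultimately show ?thesis by linarith
    qed
    with main have "profile b p + profile b q - 2 * profile b r \<le> e / 2 * s + K * s * s"
      by (simp add: K_def algebra_simps)
    also have "K * s * s \<le> e / 2 * s" using Ks nn by (intro mult_right_mono)
    finally have "profile b p + profile b q - 2 * profile b r \<le> e * s" by simp
    also have "\<dots> \<le> e * (\<beta> * norm v)" using e upper[of v] by (simp add: s_def)
    also have "\<dots> = e0 * norm v" using e(2) by (simp flip: mult.assoc)
    finally show ?thesis by (simp add: defs)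
  qed
  with \<rho> show "\<exists>d>0. \<forall>z v. norm v < d \<longrightarrow>
      profile b (N (z + v)) + profile b (N (z - v)) - 2 * profile b (N z) \<le> e0 * norm v" by blast
qed

text \<open>
  Here \<open>\<eta>\<close> encodes a modulus: a number \<open>m\<close> is admissible at \<open>x\<close> if \<open>m \<le> M\<close>, and \<open>m \<le> e\<close>
  whenever \<open>norm x < \<eta> e\<close>. The gauge is a sum of profiles at scales \<open>b k\<close> below which
  admissible numbers are at most \<open>M * (1/2) ^ k\<close>, with weights proportional to \<open>(1/2) ^ k\<close>. For a given \<open>x\<close> the single term with the
  first scale below \<open>N x\<close> already dominates.
\<close>
lemma smooth_gauge:
  fixes \<eta> :: "real \<Rightarrow> real"
  assumes M: "M > 0" and \<eta>: "\<And>e. e > 0 \<Longrightarrow> \<eta> e > 0"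
  obtains \<phi> :: "'a \<Rightarrow> real" and d L where
    "\<phi> 0 = 0" "\<And>x. 0 \<le> \<phi> x" "\<And>x. \<phi> x \<le> L * norm x"
    "\<And>e. e > 0 \<Longrightarrow> d e > 0" "almost_convex d (\<lambda>x. - \<phi> x)"
    "\<And>x m. \<lbrakk>m \<le> M; \<And>e. e > 0 \<Longrightarrow> norm x < \<eta> e \<Longrightarrow> m \<le> e\<rbrakk> \<Longrightarrow> norm x * m \<le> \<phi> x"
proof -
  define b where "b k = \<alpha> * \<eta> (M * (1/2) ^ k)" for k :: nat
  have b: "b k > 0" for k using pos M by (simp add: b_def \<eta>)
  define c where "c k = 4 * M / \<alpha> * (1/2) ^ k" for k :: nat
  have c: "c k > 0" for k using M pos by (simp add: c_def)
  have sc: "summable c" unfolding c_def by (intro summable_mult summable_geometric) simp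
  define g where "g k x = c k * profile (b k) (N x)" for k x
  have prof: "0 \<le> profile (b k) (N x)" "profile (b k) (N x) \<le> N x" for k x
    using b[of k] nonneg[of x] profile_diff_le[of "b k" "N x" 0] by (auto simp: profile_def)
  have g0: "0 \<le> g k x" for k x using c[of k] prof[of k x] by (simp add: g_def)
  have gle: "g k x \<le> c k * N x" for k x
    using c[of k] prof[of k x] by (simp add: g_def)
  have sg: "summable (\<lambda>k. g k x)" for x
    by (rule summable_comparison_test'[OF summable_mult2[OF sc, of "N x"], of 0]) (simp add: g0 gle)
  define \<phi> where "\<phi> x = (\<Sum>k. g k x)" for x
  have "convex_on UNIV \<phi>"
  proof (rule convex_onI)
    fix t :: real and x y :: 'a
    assume t: "0 < t" "t < 1"
    have "g k ((1 - t) *\<^sub>R x + t *\<^sub>R y) \<le> (1 - t) * g k x + t * g k y" for k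
    proof -
      have "convex_on UNIV (g k)"
        unfolding g_def using c[of k] by (intro convex_on_cmul convex_profile b) auto
      from convex_onD[OF this, of t x y] t show ?thesis by simp
    qed
    then have "\<phi> ((1 - t) *\<^sub>R x + t *\<^sub>R y) \<le> (\<Sum>k. (1 - t) * g k x + t * g k y)"
      unfolding \<phi>_def by (intro suminf_le summable_add summable_mult sg)
    also have "\<dots> = (1 - t) * \<phi> x + t * \<phi> y"
      unfolding \<phi>_def by (simp add: suminf_add summable_mult sg suminf_mult[OF sg, symmetric])
    finally show "\<phi> ((1 - t) *\<^sub>R x + t *\<^sub>R y) \<le> (1 - t) * \<phi> x + t * \<phi> y" .
  qed simp
  moreover have "uniformly_small_second_differences \<phi>"
    unfolding \<phi>_def
  proof (rule uniformly_small_second_differences_suminf)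
    fix k
    show "uniformly_small_second_differences (g k)"
      unfolding uniformly_small_second_differences_def
    proof (intro allI impI)
      fix e :: real assume "e > 0"
      then have "e / c k > 0" using c[of k] by simp
      then obtain d where d: "d > 0" "\<And>z v. norm v < d \<Longrightarrow> profile (b k) (N (z + v))
          + profile (b k) (N (z - v)) - 2 * profile (b k) (N z) \<le> e / c k * norm v"
        using uniformly_small_second_differencesE[OF profile_uniformly_small_second_differences[OF b]]
        by blast
      have "g k (z + v) + g k (z - v) - 2 * g k z \<le> e * norm v" if "norm v < d" for z v
        using mult_left_mono[OF d(2)[OF that, of z], of "c k"] c[of k]
        by (simp add: g_def algebra_simps)
      with d(1) show "\<exists>d>0. \<forall>z v. norm v < d \<longrightarrow> g k (z + v) + g k (z - v) - 2 * g k z \<le> e * norm v"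
        by blast
    qed
    show "g k (z + v) + g k (z - v) - 2 * g k z \<le> (c k * (2 * \<beta>)) * norm v" for z v
      using mult_left_mono[OF profile_second_difference_le[OF b, of k z v], of "c k"] c[of k]
      by (simp add: g_def algebra_simps)
  qed (intro summable_mult2 sc sg)+
  ultimately obtain d where d: "\<And>e. e > 0 \<Longrightarrow> d e > 0" "almost_convex d (\<lambda>x. - \<phi> x)"
    using almost_convex_uminus_if_convex by blast
  have \<phi>0: "\<phi> 0 = 0" by (simp add: \<phi>_def g_def zero profile_def)
  have \<phi>nn: "0 \<le> \<phi> x" for x unfolding \<phi>_def by (intro suminf_nonneg sg g0)
  have \<phi>le: "\<phi> x \<le> (\<Sum>k. c k) * \<beta> * norm x" for x
  proof -
    have "\<phi> x \<le> (\<Sum>k. c k * N x)" unfolding \<phi>_def by (intro suminf_le gle sg summable_mult2 sc)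
    also have "\<dots> = (\<Sum>k. c k) * N x" by (rule suminf_mult2[OF sc, symmetric])
    also have "\<dots> \<le> (\<Sum>k. c k) * (\<beta> * norm x)"
      using upper[of x] c by (intro mult_left_mono suminf_nonneg sc) (auto simp: less_imp_le)
    finally show ?thesis by (simp add: mult.assoc)
  qed
  have dom: "norm x * m \<le> \<phi> x" if m: "m \<le> M" "\<And>e. e > 0 \<Longrightarrow> norm x < \<eta> e \<Longrightarrow> m \<le> e" for x m
  proof -
    have small: "m \<le> M * (1/2) ^ k" if "N x < b k" for k
    proof (rule m(2))
      have "\<alpha> * norm x < \<alpha> * \<eta> (M * (1/2) ^ k)" using that lower[of x] by (simp add: b_def)
      then show "norm x < \<eta> (M * (1/2) ^ k)" using pos by simp
    qed (use M in simp)
    show ?thesis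
    proof (cases "\<exists>k. b k \<le> N x")
      case False
      then have *: "m \<le> M * (1/2) ^ k" for k using small[of k] by (simp add: not_le)
      have "(\<lambda>k. M * (1/2) ^ k) \<longlonglongrightarrow> M * 0" by (intro tendsto_intros LIMSEQ_power_zero) simp
      then have "m \<le> 0" using * by (intro LIMSEQ_le_const) auto
      then have "norm x * m \<le> 0" by (simp add: mult_nonneg_nonpos)
      then show ?thesis using \<phi>nn[of x] by linarith
    next
      case True
      define k where "k = (LEAST k. b k \<le> N x)"
      have bk: "b k \<le> N x" unfolding k_def using True by (metis (mono_tags, lifting) LeastI)
      have mk: "m \<le> 2 * M * (1/2) ^ k"
      proof (cases k)
        case 0 then show ?thesis using m(1) M by simp
      next
        case (Suc j)
        then have "\<not> b j \<le> N x" using not_less_Least[of j "\<lambda>k. b k \<le> N x"] by (simp add: k_def)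
        then show ?thesis using small[of j] Suc by simp
      qed
      have "N x > 0" using bk b[of k] by simp
      have "N x / 2 \<le> profile (b k) (N x)"
      proof -
        have "N x * (b k + N x) \<le> 2 * (N x)\<^sup>2"
          using mult_left_mono[OF bk, of "N x"] \<open>N x > 0\<close> by (simp add: power2_eq_square algebra_simps)
        then show ?thesis using b[of k] \<open>N x > 0\<close> by (simp add: profile_def field_simps)
      qed
      then have "\<alpha> * norm x / 2 \<le> profile (b k) (N x)" using lower[of x] by simp
      then have "c k * (\<alpha> * norm x / 2) \<le> g k x" unfolding g_def using c[of k] by simp
      moreover have "c k * (\<alpha> * norm x / 2) = norm x * (2 * M * (1/2) ^ k)"
        using pos by (simp add: c_def)
      moreover have "norm x * m \<le> norm x * (2 * M * (1/2) ^ k)" using mk by (intro mult_left_mono) auto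
      moreover have "g k x \<le> \<phi> x"
        unfolding \<phi>_def using sum_le_suminf[OF sg, of "{k}" x] g0 by simp
      ultimately show ?thesis by linarith
    qed
  qed
  show thesis by (rule that[OF \<phi>0 \<phi>nn \<phi>le d dom])
qed

end

lemma uniformly_smooth_normI:
  assumes "equivalent_norm N" "uniformly_smooth N"
  obtains \<alpha> \<beta> where "uniformly_smooth_norm N \<alpha> \<beta>"
  using assms unfolding equivalent_norm_def uniformly_smooth_norm_def by metis

section \<open>Extension of bounded data\<close>

lemma C1_plus_on_const: "C1_plus_on V (\<lambda>x. c)"
  unfolding C1_plus_on_def
  by (intro exI[of _ "\<lambda>x. 0"] conjI uniformly_continuous_on_const) (simp add: zero_blinfun.rep_eq)

context uniformly_smooth_norm
begin

text \<open>
  Boundedness of \<open>f\<close> and \<open>G\<close> makes the error in condition W at most a multiple of the distance at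
  all scales, not only at small ones. This is needed because the supporting functions are compared at
  points of \<open>E\<close> at arbitrary distance.
\<close>
theorem bounded_C1_plus_extension:
  fixes E :: "'a set" and f :: "'a \<Rightarrow> real" and G :: "'a \<Rightarrow> 'a \<Rightarrow>\<^sub>L real"
  assumes W: "cond_W E f G" and bf: "bounded (f ` E)" and bG: "bounded (G ` E)"
  obtains F where "C1_plus_on UNIV F" "\<And>x. x \<in> E \<Longrightarrow> F x = f x"
proof (cases "E = {}")
  case True
  show thesis by (rule that[OF C1_plus_on_const]) (use True in simp)
next
  case False
  then obtain y0 where y0: "y0 \<in> E" by blast
  define R where "R y z = \<bar>f y - f z - G z (y - z)\<bar>" for y z
  obtain B where B: "B > 0" "\<And>y. y \<in> E \<Longrightarrow> \<bar>f y\<bar> \<le> B" using bf by (auto simp: bounded_pos)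
  obtain C where C: "C > 0" "\<And>y. y \<in> E \<Longrightarrow> norm (G y) \<le> C" using bG by (auto simp: bounded_pos)
  have "\<exists>\<delta>>0. \<forall>y\<in>E. \<forall>z\<in>E. norm (y - z) < \<delta> \<longrightarrow> R y z \<le> e * norm (y - z) \<and> norm (G y - G z) \<le> e"
    if e: "e > 0" for e
  proof -
    obtain d1 where d1: "d1 > 0" "\<And>x y. x \<in> E \<Longrightarrow> y \<in> E \<Longrightarrow> dist y x < d1 \<Longrightarrow> dist (G y) (G x) < e"
      using W[unfolded cond_W_def, THEN conjunct1] e unfolding uniformly_continuous_on_def by meson
    obtain d2 where d2: "d2 > 0" "\<And>x y. x \<in> E \<Longrightarrow> y \<in> E \<Longrightarrow> norm (y - x) < d2 \<Longrightarrow> R y x \<le> e * norm (y - x)"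
      using W[unfolded cond_W_def, THEN conjunct2] e unfolding R_def by meson
    show ?thesis
      using d1 d2 by (intro exI[of _ "min d1 d2"]) (auto simp: dist_norm intro!: less_imp_le)
  qed
  then obtain \<delta> where \<delta>: "\<And>e. e > 0 \<Longrightarrow> \<delta> e > 0"
    and \<delta>R: "\<And>e y z. e > 0 \<Longrightarrow> y \<in> E \<Longrightarrow> z \<in> E \<Longrightarrow> norm (y - z) < \<delta> e \<Longrightarrow> R y z \<le> e * norm (y - z)"
    and \<delta>G: "\<And>e y z. e > 0 \<Longrightarrow> y \<in> E \<Longrightarrow> z \<in> E \<Longrightarrow> norm (y - z) < \<delta> e \<Longrightarrow> norm (G y - G z) \<le> e"
    by metis
  define K where "K = 1 + 2 * C + (2 * B / \<delta> 1 + C)"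
  have K: "2 * C \<le> K" "2 * B / \<delta> 1 + C \<le> K" "1 \<le> K" "K > 0"
    using B C \<delta>[of 1] by (auto simp: K_def add_pos_nonneg intro!: add_nonneg_nonneg divide_nonneg_pos)
  have RK: "R y z \<le> K * norm (y - z)" if "y \<in> E" "z \<in> E" for y z
  proof (cases "norm (y - z) < \<delta> 1")
    case True
    have "R y z \<le> 1 * norm (y - z)" using \<delta>R[OF _ that True] by simp
    also have "\<dots> \<le> K * norm (y - z)" using K by (intro mult_right_mono) auto
    finally show ?thesis .
  next
    case False
    have "\<bar>G z (y - z)\<bar> \<le> C * norm (y - z)"
      using norm_blinfun[of "G z" "y - z"] mult_right_mono[OF C(2)[OF that(2)], of "norm (y - z)"] by simp
    moreover have "2 * B \<le> 2 * B / \<delta> 1 * norm (y - z)"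
      using False \<delta>[of 1] B by (simp add: field_simps)
    ultimately have "R y z \<le> (2 * B / \<delta> 1 + C) * norm (y - z)"
      using B(2)[OF that(1)] B(2)[OF that(2)] by (simp add: R_def algebra_simps)
    also have "\<dots> \<le> K * norm (y - z)" using K by (intro mult_right_mono) auto
    finally show ?thesis .
  qed
  have GK: "norm (G y - G z) \<le> K" if "y \<in> E" "z \<in> E" for y z
    using norm_triangle_ineq4[of "G y" "G z"] C(2)[OF that(1)] C(2)[OF that(2)] K by linarith
  \<comment> \<open>The larger of the distances from \<open>x\<close> to \<open>y\<close> and \<open>z\<close> is at least half of \<open>norm (y - z)\<close>, hence the
      factor \<open>2\<close>; the ratio \<open>m\<close> below adds up at most three error constants, hence the \<open>4\<close>.\<close>
  have "4 * K > 0" "\<And>e. e > 0 \<Longrightarrow> \<delta> (e / 4) / 2 > 0" using K \<delta> by simp_all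
  then obtain \<phi> :: "'a \<Rightarrow> real" and d L where \<phi>: "\<phi> 0 = 0" "\<And>x. 0 \<le> \<phi> x" "\<And>x. \<phi> x \<le> L * norm x"
    and d: "\<And>e. e > 0 \<Longrightarrow> d e > 0" "almost_convex d (\<lambda>x. - \<phi> x)"
    and dom: "\<And>x m. \<lbrakk>m \<le> 4 * K; \<And>e. e > 0 \<Longrightarrow> norm x < \<delta> (e / 4) / 2 \<Longrightarrow> m \<le> e\<rbrakk> \<Longrightarrow> norm x * m \<le> \<phi> x"
    by (rule smooth_gauge[of "4 * K" "\<lambda>e. \<delta> (e / 4) / 2"]) blast+
  define up where "up y x = f y + G y (x - y) + \<phi> (x - y)" for y x
  define lo where "lo y x = f y + G y (x - y) - \<phi> (x - y)" for y x
  have lo_le_up: "lo y x \<le> up z x" if yz: "y \<in> E" "z \<in> E" for x y z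
  proof -
    define s where "s = max (norm (x - y)) (norm (x - z))"
    have yzs: "norm (y - z) \<le> 2 * s"
      using norm_triangle_ineq4[of "x - z" "x - y"] by (simp add: s_def)
    have err: "R y z + norm (G y - G z) * norm (x - y) \<le> \<phi> (x - y) + \<phi> (x - z)"
    proof -
      \<comment> \<open>This upper bound for the ratio of the error to \<open>s\<close> is admissible for the gauge at the more distant of the two points.\<close>
      define m where "m = (if y = z then 0 else 2 * (R y z / norm (y - z))) + norm (G y - G z)"
      have Rm: "R y z / norm (y - z) \<le> e"
        if "y \<noteq> z" "R y z \<le> e * norm (y - z)" for e using that by (simp add: divide_le_eq)
      have m1: "m \<le> 4 * K"
        using RK[OF yz] GK[OF yz] Rm[of K] K(4) by (auto simp: m_def)
      have m2: "m \<le> e" if "e > 0" "s < \<delta> (e / 4) / 2" for e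
        using \<delta>R[OF _ yz, of "e / 4"] \<delta>G[OF _ yz, of "e / 4"] Rm[of "e / 4"] that yzs by (auto simp: m_def)
      have m0: "m \<ge> 0" by (auto simp: m_def R_def)
      have "R y z \<le> s * (2 * (R y z / norm (y - z)))" if "y \<noteq> z"
        using mult_right_mono[OF yzs, of "R y z / norm (y - z)"] that by (simp add: R_def mult_ac)
      then have "R y z + norm (G y - G z) * norm (x - y) \<le> s * m"
        using mult_left_mono[of "norm (x - y)" s "norm (G y - G z)"]
        by (auto simp: m_def R_def algebra_simps s_def)
      also have "s * m \<le> \<phi> (x - y) + \<phi> (x - z)"
      proof (cases "norm (x - y) \<ge> norm (x - z)")
        case True
        then have "s = norm (x - y)" by (simp add: s_def)
        then have "s * m \<le> \<phi> (x - y)" using dom[of m "x - y"] m1 m2 by simp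
        then show ?thesis using \<phi>(2)[of "x - z"] by linarith
      next
        case False
        then have "s = norm (x - z)" by (simp add: s_def)
        then have "s * m \<le> \<phi> (x - z)" using dom[of m "x - z"] m1 m2 by simp
        then show ?thesis using \<phi>(2)[of "x - y"] by linarith
      qed
      finally show ?thesis .
    qed
    have "G y (x - y) - G z (x - z) = (G y - G z) (x - y) - G z (y - z)"
      by (simp add: blinfun.bilinear_simps)
    moreover have "(G y - G z) (x - y) \<le> norm (G y - G z) * norm (x - y)"
      using norm_blinfun[of "G y - G z" "x - y"] by simp
    ultimately show ?thesis using err by (simp add: lo_def up_def R_def)
  qed
  have affine: "G y (l *\<^sub>R a + (1 - l) *\<^sub>R b - y) = l * G y (a - y) + (1 - l) * G y (b - y)" for y a b l
    by (simp add: blinfun.bilinear_simps algebra_simps)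
  have shift: "l *\<^sub>R a + (1 - l) *\<^sub>R b - y = l *\<^sub>R (a - y) + (1 - l) *\<^sub>R (b - y)" for y a b :: 'a and l
    by (simp add: algebra_simps)
  have ac: "almost_convex d (lo y)" "almost_convex d (\<lambda>x. - up y x)" for y
  proof -
    have "- \<phi> (l *\<^sub>R a + (1 - l) *\<^sub>R b - y) \<le> l * - \<phi> (a - y) + (1 - l) * - \<phi> (b - y) + l * (1 - l) * (e * norm (a - b))"
      if "0 < e" "0 \<le> l" "l \<le> 1" "norm (a - b) < d e" for e l a b
      using almost_convexD[OF d(2) that(1-3), of "a - y" "b - y"] that(4) by (simp add: shift)
    then show "almost_convex d (lo y)" "almost_convex d (\<lambda>x. - up y x)"
      unfolding almost_convex_def lo_def up_def affine
      by (auto simp: algebra_simps)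
  qed
  define g1 where "g1 x = (SUP y\<in>E. lo y x)" for x
  define g2 where "g2 x = - (SUP y\<in>E. - up y x)" for x
  have bdd1: "bdd_above ((\<lambda>y. lo y x) ` E)" for x
    by (rule bdd_aboveI[of _ "up y0 x"]) (use lo_le_up y0 in auto)
  have bdd2: "bdd_above ((\<lambda>y. - up y x) ` E)" for x
    by (rule bdd_aboveI[of _ "- lo y0 x"]) (use lo_le_up y0 in auto)
  have g1: "lo y x \<le> g1 x" if "y \<in> E" for x y unfolding g1_def by (rule cSUP_upper[OF that bdd1])
  have g2: "g2 x \<le> up y x" if "y \<in> E" for x y
    using cSUP_upper[OF that bdd2] by (simp add: g2_def minus_le_iff)
  have g1_le_up: "g1 x \<le> up z x" if "z \<in> E" for z x
    unfolding g1_def using lo_le_up that y0 by (intro cSUP_least) auto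
  have "(SUP y\<in>E. - up y x) \<le> - g1 x" for x
    using y0 g1_le_up by (intro cSUP_least) auto
  then have g12: "g1 x \<le> g2 x" for x by (simp add: g2_def le_minus_iff)
  have "almost_convex d g1"
    using almost_convex_SUP[of "lo ` E" d] y0 ac(1) bdd1 by (auto simp: g1_def[abs_def] image_image)
  moreover have "almost_convex d (\<lambda>x. - g2 x)"
    using almost_convex_SUP[of "(\<lambda>y x. - up y x) ` E" d] y0 ac(2) bdd2 by (auto simp: g2_def image_image)
  moreover note g12
  ultimately obtain h where h: "\<And>x. g1 x \<le> h x" "\<And>x. h x \<le> g2 x"
    "almost_convex d h" "almost_convex d (\<lambda>x. - h x)"
    by (rule almost_convex_concave_insertion) blast
  have "h x = f x" if "x \<in> E" for x
    using g1[OF that, of x] g2[OF that, of x] h(1,2)[of x] by (simp add: lo_def up_def \<phi>(1) blinfun.zero_right)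
  moreover have "C1_plus_on UNIV h"
  proof (rule C1_plus_on_if_almost_convex_concave[OF h(3,4) d(1)])
    fix x
    have L: "L * norm w \<le> \<bar>L\<bar> * norm w" for w :: 'a by (intro mult_right_mono) auto
    have "\<bar>h (x + v)\<bar> \<le> B + (C + \<bar>L\<bar>) * (norm (x - y0) + 1)" if v: "norm v < 1" for v
    proof -
      define w where "w = x + v - y0"
      have "norm w \<le> norm (x - y0) + 1"
        using norm_triangle_ineq[of "x - y0" v] v by (simp add: w_def algebra_simps)
      then have nw: "(C + \<bar>L\<bar>) * norm w \<le> (C + \<bar>L\<bar>) * (norm (x - y0) + 1)"
        using C by (intro mult_left_mono) auto
      have "\<bar>G y0 w\<bar> \<le> C * norm w"
        using norm_blinfun[of "G y0" w] mult_right_mono[OF C(2)[OF y0], of "norm w"] by simp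
      then have "\<bar>h (x + v)\<bar> \<le> B + (C + \<bar>L\<bar>) * norm w"
        using order_trans[OF g1[OF y0] h(1), of "x + v"] order_trans[OF h(2) g2[OF y0], of "x + v"]
          B(2)[OF y0] \<phi>(3)[of w] L[of w]
        unfolding lo_def up_def w_def[symmetric] distrib_right by linarith
      with nw show ?thesis by linarith
    qed
    then show "\<exists>r>0. \<exists>B. \<forall>v. norm v < r \<longrightarrow> \<bar>h (x + v)\<bar> \<le> B" by (intro exI[of _ 1]) auto
  qed
  ultimately show thesis using that by blast
qed

end

section \<open>Local calculus of functions with uniformly continuous derivative\<close>

definition C1_plus_near :: "'a::real_normed_vector \<Rightarrow> ('a \<Rightarrow> real) \<Rightarrow> bool" where
  "C1_plus_near x f \<longleftrightarrow> (\<exists>r>0. C1_plus_on (ball x r) f)"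

lemma uniformly_continuous_on_subset:
  fixes f :: "'a::metric_space \<Rightarrow> 'b::metric_space"
  shows "uniformly_continuous_on S f \<Longrightarrow> T \<subseteq> S \<Longrightarrow> uniformly_continuous_on T f"
  unfolding uniformly_continuous_on_def by (meson subset_iff)

lemma C1_plus_on_subset:
  assumes "C1_plus_on V f" "W \<subseteq> V"
  shows "C1_plus_on W f"
  using assms uniformly_continuous_on_subset unfolding C1_plus_on_def by (meson subset_iff)

lemma C1_plus_nearI: "\<lbrakk>C1_plus_on V f; open V; x \<in> V\<rbrakk> \<Longrightarrow> C1_plus_near x f"
  unfolding C1_plus_near_def by (meson C1_plus_on_subset open_contains_ball)

lemma C1_plus_loc_on_iff_near:
  assumes "open U"
  shows "C1_plus_loc_on U f \<longleftrightarrow> (\<forall>x\<in>U. C1_plus_near x f)"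
proof
  assume "C1_plus_loc_on U f"
  then show "\<forall>x\<in>U. C1_plus_near x f"
    unfolding C1_plus_loc_on_def by (meson C1_plus_nearI)
next
  assume near: "\<forall>x\<in>U. C1_plus_near x f"
  show "C1_plus_loc_on U f"
    unfolding C1_plus_loc_on_def
  proof
    fix x assume x: "x \<in> U"
    with near obtain r where r: "r > 0" "C1_plus_on (ball x r) f" unfolding C1_plus_near_def by blast
    show "\<exists>V. open V \<and> x \<in> V \<and> V \<subseteq> U \<and> C1_plus_on V f"
      using x r assms by (intro exI[of _ "ball x r \<inter> U"]) (auto intro: C1_plus_on_subset)
  qed
qed

lemma C1_plus_near_cong:
  assumes "C1_plus_near x f" "r > 0" and eq: "\<And>y. dist x y < r \<Longrightarrow> g y = f y"
  shows "C1_plus_near x g"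
proof -
  obtain s D where s: "s > 0" and D: "\<And>y. y \<in> ball x s \<Longrightarrow> (f has_derivative blinfun_apply (D y)) (at y)"
    and uc: "uniformly_continuous_on (ball x s) D"
    using assms(1) unfolding C1_plus_near_def C1_plus_on_def by blast
  have "(g has_derivative blinfun_apply (D y)) (at y)" if "y \<in> ball x (min r s)" for y
    by (rule has_derivative_transform_within_open[OF D, of y "ball x (min r s)"]) (use that eq in auto)
  moreover have "uniformly_continuous_on (ball x (min r s)) D"
    by (rule uniformly_continuous_on_subset[OF uc]) auto
  ultimately have "C1_plus_on (ball x (min r s)) g" unfolding C1_plus_on_def by blast
  then show ?thesis using \<open>r > 0\<close> s by (intro C1_plus_nearI[of "ball x (min r s)"]) auto
qed

text \<open>
  On a small ball the derivative is bounded, hence the function is Lipschitz and bounded. Products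
  need this, since multiplication does not preserve uniform continuity of unbounded functions.
\<close>
lemma C1_plus_near_bounded:
  assumes "C1_plus_near x f"
  obtains r B and D :: "'a::real_normed_vector \<Rightarrow> 'a \<Rightarrow>\<^sub>L real" where "r > 0"
    "\<And>y. y \<in> ball x r \<Longrightarrow> (f has_derivative blinfun_apply (D y)) (at y)"
    "uniformly_continuous_on (ball x r) D" "uniformly_continuous_on (ball x r) f"
    "\<And>y. y \<in> ball x r \<Longrightarrow> norm (D y) \<le> B" "\<And>y. y \<in> ball x r \<Longrightarrow> norm (f y) \<le> B"
proof -
  obtain s and D :: "'a \<Rightarrow> 'a \<Rightarrow>\<^sub>L real" where s: "s > 0"
    and D: "\<And>y. y \<in> ball x s \<Longrightarrow> (f has_derivative blinfun_apply (D y)) (at y)"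
    and uc: "uniformly_continuous_on (ball x s) D"
    using assms unfolding C1_plus_near_def C1_plus_on_def by blast
  obtain d where d: "d > 0" "\<And>y z. y \<in> ball x s \<Longrightarrow> z \<in> ball x s \<Longrightarrow> dist z y < d \<Longrightarrow> dist (D z) (D y) < 1"
    using uc unfolding uniformly_continuous_on_def by (meson zero_less_one)
  define r where "r = min d s"
  have r: "r > 0" using d s by (simp add: r_def)
  have sub: "ball x r \<subseteq> ball x s" by (auto simp: r_def)
  define B where "B = norm (D x) + 1"
  have DB: "norm (D y) \<le> B" if "y \<in> ball x r" for y
  proof -
    have "dist (D y) (D x) < 1" using that s by (intro d) (auto simp: r_def dist_commute)
    then show ?thesis using norm_triangle_sub[of "D y" "D x"] by (simp add: B_def dist_norm)
  qed
  have lip: "norm (f y - f z) \<le> B * norm (y - z)" if "y \<in> ball x r" "z \<in> ball x r" for y z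
  proof (rule differentiable_bound[of "ball x r" f "\<lambda>y. blinfun_apply (D y)"])
    show "(f has_derivative blinfun_apply (D u)) (at u within ball x r)" if "u \<in> ball x r" for u
      using D sub that by (blast intro: has_derivative_at_withinI)
    show "onorm (blinfun_apply (D u)) \<le> B" if "u \<in> ball x r" for u
      using DB[OF that] by (simp add: norm_blinfun.rep_eq)
  qed (use that in auto)
  have "B > 0" by (simp add: B_def add_nonneg_pos)
  show thesis
  proof (rule that[OF r])
    show "uniformly_continuous_on (ball x r) D" by (rule uniformly_continuous_on_subset[OF uc sub])
    show "uniformly_continuous_on (ball x r) f"
      unfolding uniformly_continuous_on_def
    proof (intro allI impI)
      fix e :: real assume "e > 0"
      have "dist (f z) (f y) < e" if "y \<in> ball x r" "z \<in> ball x r" "dist z y < e / B" for y z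
        using lip[OF that(2,1)] that(3) \<open>B > 0\<close> by (simp add: dist_norm field_simps)
      then show "\<exists>d>0. \<forall>y\<in>ball x r. \<forall>z\<in>ball x r. dist z y < d \<longrightarrow> dist (f z) (f y) < e"
        using \<open>e > 0\<close> \<open>B > 0\<close> by (intro exI[of _ "e / B"]) auto
    qed
    fix y assume y: "y \<in> ball x r"
    then show "(f has_derivative blinfun_apply (D y)) (at y)" using D sub by blast
    show "norm (D y) \<le> max B (\<bar>f x\<bar> + B * r)" using DB[OF y] by simp
    have "norm (f y - f x) \<le> B * norm (y - x)" using lip[OF y] r by simp
    also have "\<dots> \<le> B * r" using y \<open>B > 0\<close> by (intro mult_left_mono) (auto simp: dist_norm norm_minus_commute)
    finally show "norm (f y) \<le> max B (\<bar>f x\<bar> + B * r)" by simp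
  qed
qed

lemma C1_plus_near_const: "C1_plus_near x (\<lambda>x. c)"
  by (rule C1_plus_nearI[OF C1_plus_on_const open_UNIV UNIV_I])

lemma C1_plus_near_add:
  assumes "C1_plus_near x f" "C1_plus_near x g"
  shows "C1_plus_near x (\<lambda>x. f x + g x)"
proof -
  obtain r D where r: "r > 0" and D: "\<And>y. y \<in> ball x r \<Longrightarrow> (f has_derivative blinfun_apply (D y)) (at y)"
    and uD: "uniformly_continuous_on (ball x r) D"
    using assms(1) unfolding C1_plus_near_def C1_plus_on_def by blast
  obtain s E where s: "s > 0" and E: "\<And>y. y \<in> ball x s \<Longrightarrow> (g has_derivative blinfun_apply (E y)) (at y)"
    and uE: "uniformly_continuous_on (ball x s) E"
    using assms(2) unfolding C1_plus_near_def C1_plus_on_def by blast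
  have "((\<lambda>x. f x + g x) has_derivative blinfun_apply (D y + E y)) (at y)" if "y \<in> ball x (min r s)" for y
    using has_derivative_add[OF D E, of y] that by (simp add: plus_blinfun.rep_eq)
  moreover have "uniformly_continuous_on (ball x (min r s)) (\<lambda>y. D y + E y)"
    by (intro uniformly_continuous_on_add uniformly_continuous_on_subset[OF uD]
        uniformly_continuous_on_subset[OF uE]) auto
  ultimately have "C1_plus_on (ball x (min r s)) (\<lambda>x. f x + g x)"
    unfolding C1_plus_on_def by (intro exI[of _ "\<lambda>y. D y + E y"]) auto
  then show ?thesis using r s unfolding C1_plus_near_def by (intro exI[of _ "min r s"]) auto
qed

lemma uniformly_continuous_on_scaleR_bounded:
  fixes f :: "'a::metric_space \<Rightarrow> real" and D :: "'a \<Rightarrow> 'b::real_normed_vector"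
  assumes f: "uniformly_continuous_on S f" and D: "uniformly_continuous_on S D"
    and fB: "\<And>x. x \<in> S \<Longrightarrow> \<bar>f x\<bar> \<le> B" and DC: "\<And>x. x \<in> S \<Longrightarrow> norm (D x) \<le> C"
  shows "uniformly_continuous_on S (\<lambda>x. f x *\<^sub>R D x)"
  unfolding uniformly_continuous_on_def
proof (intro allI impI)
  fix e :: real assume "e > 0"
  define K where "K = \<bar>B\<bar> + \<bar>C\<bar> + 1"
  have K: "K > 0" by (simp add: K_def add_nonneg_pos)
  then have "e / K > 0" using \<open>e > 0\<close> by simp
  then obtain d1 where d1: "d1 > 0" "\<And>x y. x \<in> S \<Longrightarrow> y \<in> S \<Longrightarrow> dist y x < d1 \<Longrightarrow> dist (f y) (f x) < e / K"
    using f unfolding uniformly_continuous_on_def by meson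
  obtain d2 where d2: "d2 > 0" "\<And>x y. x \<in> S \<Longrightarrow> y \<in> S \<Longrightarrow> dist y x < d2 \<Longrightarrow> dist (D y) (D x) < e / K"
    using D \<open>e / K > 0\<close> unfolding uniformly_continuous_on_def by meson
  have "dist (f y *\<^sub>R D y) (f x *\<^sub>R D x) < e" if xy: "x \<in> S" "y \<in> S" "dist y x < min d1 d2" for x y
  proof -
    have "f y *\<^sub>R D y - f x *\<^sub>R D x = f y *\<^sub>R (D y - D x) + (f y - f x) *\<^sub>R D x"
      by (simp add: algebra_simps)
    then have "dist (f y *\<^sub>R D y) (f x *\<^sub>R D x) \<le> \<bar>f y\<bar> * norm (D y - D x) + \<bar>f y - f x\<bar> * norm (D x)"
      by (metis dist_norm norm_triangle_ineq norm_scaleR)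
    also have "\<dots> \<le> \<bar>B\<bar> * (e / K) + (e / K) * \<bar>C\<bar>"
      using d1(2)[of x y] d2(2)[of x y] xy fB[of y] DC[of x] \<open>e / K > 0\<close>
      by (intro add_mono mult_mono) (auto simp: dist_norm)
    also have "\<dots> = (\<bar>B\<bar> + \<bar>C\<bar>) * (e / K)" by (simp add: algebra_simps)
    also have "\<dots> < K * (e / K)" using \<open>e / K > 0\<close> by (intro mult_strict_right_mono) (simp_all add: K_def)
    also have "\<dots> = e" using K by simp
    finally show ?thesis .
  qed
  then show "\<exists>d>0. \<forall>x\<in>S. \<forall>y\<in>S. dist y x < d \<longrightarrow> dist (f y *\<^sub>R D y) (f x *\<^sub>R D x) < e"
    using d1(1) d2(1) by (intro exI[of _ "min d1 d2"]) auto
qed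

lemma C1_plus_near_mult:
  assumes "C1_plus_near x f" "C1_plus_near x g"
  shows "C1_plus_near x (\<lambda>x. f x * g x)"
proof -
  from assms(1) obtain r B D where r: "r > 0"
    and D: "\<And>y. y \<in> ball x r \<Longrightarrow> (f has_derivative blinfun_apply (D y)) (at y)"
    and uD: "uniformly_continuous_on (ball x r) D" and uf: "uniformly_continuous_on (ball x r) f"
    and DB: "\<And>y. y \<in> ball x r \<Longrightarrow> norm (D y) \<le> B" and fB: "\<And>y. y \<in> ball x r \<Longrightarrow> norm (f y) \<le> B"
    by (rule C1_plus_near_bounded) blast
  from assms(2) obtain s C E where s: "s > 0"
    and E: "\<And>y. y \<in> ball x s \<Longrightarrow> (g has_derivative blinfun_apply (E y)) (at y)"
    and uE: "uniformly_continuous_on (ball x s) E" and ug: "uniformly_continuous_on (ball x s) g"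
    and EC: "\<And>y. y \<in> ball x s \<Longrightarrow> norm (E y) \<le> C" and gC: "\<And>y. y \<in> ball x s \<Longrightarrow> norm (g y) \<le> C"
    by (rule C1_plus_near_bounded) blast
  define b where "b = ball x (min r s)"
  have sub: "b \<subseteq> ball x r" "b \<subseteq> ball x s" by (auto simp: b_def)
  note uc = uniformly_continuous_on_subset
  have "((\<lambda>x. f x * g x) has_derivative blinfun_apply (f y *\<^sub>R E y + g y *\<^sub>R D y)) (at y)" if "y \<in> b" for y
  proof -
    have "blinfun_apply (f y *\<^sub>R E y + g y *\<^sub>R D y) = (\<lambda>h. f y * E y h + D y h * g y)"
      by (auto simp: blinfun.bilinear_simps)
    moreover have "y \<in> ball x r" "y \<in> ball x s" using that sub by auto
    ultimately show ?thesis using has_derivative_mult[OF D E] by metis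
  qed
  moreover have "uniformly_continuous_on b (\<lambda>y. f y *\<^sub>R E y + g y *\<^sub>R D y)"
  proof (intro uniformly_continuous_on_add)
    have "\<bar>f y\<bar> \<le> B" "norm (E y) \<le> C" "\<bar>g y\<bar> \<le> C" "norm (D y) \<le> B" if "y \<in> b" for y
      using that sub fB[of y] EC[of y] gC[of y] DB[of y] by auto
    note bounds = this
    show "uniformly_continuous_on b (\<lambda>y. f y *\<^sub>R E y)"
      by (rule uniformly_continuous_on_scaleR_bounded[OF uc[OF uf sub(1)] uc[OF uE sub(2)] bounds(1,2)])
    show "uniformly_continuous_on b (\<lambda>y. g y *\<^sub>R D y)"
      by (rule uniformly_continuous_on_scaleR_bounded[OF uc[OF ug sub(2)] uc[OF uD sub(1)] bounds(3,4)])
  qed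
  ultimately have "C1_plus_on b (\<lambda>x. f x * g x)"
    unfolding C1_plus_on_def by (intro exI[of _ "\<lambda>y. f y *\<^sub>R E y + g y *\<^sub>R D y"]) auto
  then show ?thesis using r s unfolding C1_plus_near_def b_def by (intro exI[of _ "min r s"]) auto
qed

lemma C1_plus_near_sum:
  fixes n :: nat
  assumes "\<And>k. k < n \<Longrightarrow> C1_plus_near x (f k)"
  shows "C1_plus_near x (\<lambda>x. \<Sum>k<n. f k x)"
  using assms by (induction n) (auto intro: C1_plus_near_const C1_plus_near_add)

lemma C1_plus_near_prod:
  fixes n :: nat
  assumes "\<And>k. k < n \<Longrightarrow> C1_plus_near x (f k)"
  shows "C1_plus_near x (\<lambda>x. \<Prod>k<n. f k x)"
  using assms by (induction n) (auto intro: C1_plus_near_const C1_plus_near_mult)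

section \<open>Gluing\<close>

lemma sum_telescoping_complements:
  fixes h :: "nat \<Rightarrow> real"
  shows "(\<Sum>k<n. h k * (\<Prod>j<k. 1 - h j)) = 1 - (\<Prod>j<n. 1 - h j)"
  by (induction n) (auto simp: algebra_simps)

text \<open>
  Stone's refinement of the cover by the balls \<open>ball s (d s)\<close>. Well-order the centres. The set \<open>T n s\<close>
  consists of the points at depth \<open>1 / Suc n\<close> in the ball of \<open>s\<close> that lie in no earlier ball; a point of \<open>T n t\<close> with
  \<open>t\<close> later than \<open>s\<close> is outside the ball of \<open>s\<close> and therefore far from \<open>T n s\<close>.
\<close>
lemma Stone_sigma_discrete_refinement:
  fixes U :: "'a::metric_space set" and d :: "'a \<Rightarrow> real"
  assumes d: "\<And>x. x \<in> U \<Longrightarrow> d x > 0"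
  obtains T :: "nat \<Rightarrow> 'a \<Rightarrow> 'a set" where
    "\<And>n s x. x \<in> T n s \<Longrightarrow> s \<in> U \<and> ball x (1 / Suc n) \<subseteq> ball s (d s)"
    "\<And>n s t x y. \<lbrakk>x \<in> T n s; y \<in> T n t; s \<noteq> t\<rbrakk> \<Longrightarrow> 1 / Suc n \<le> dist x y"
    "\<And>x. x \<in> U \<Longrightarrow> \<exists>n s. x \<in> T n s"
proof -
  obtain r :: "'a rel" where wo: "well_order_on UNIV r" using well_order_on by blast
  then have wf: "wf (r - Id)" and tot: "total r"
    by (auto simp: well_order_on_def linear_order_on_def)
  define T where "T n s = {x. s \<in> U \<and> ball x (1 / Suc n) \<subseteq> ball s (d s)
      \<and> (\<forall>t\<in>U. (t, s) \<in> r - Id \<longrightarrow> x \<notin> ball t (d t))}" for n s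
  have apart: "1 / Suc n \<le> dist x y" if "x \<in> T n s" "y \<in> T n t" "(s, t) \<in> r - Id" for n s t x y
  proof (rule ccontr)
    assume "\<not> 1 / Suc n \<le> dist x y"
    then have "y \<in> ball x (1 / Suc n)" by simp
    then have "y \<in> ball s (d s)" using that(1) unfolding T_def by blast
    then show False using that by (auto simp: T_def)
  qed
  show thesis
  proof (rule that[of T])
    show "1 / Suc n \<le> dist x y" if "x \<in> T n s" "y \<in> T n t" "s \<noteq> t" for n s t x y
    proof -
      have "(s, t) \<in> r - Id \<or> (t, s) \<in> r - Id" using tot that(3) by (auto simp: total_on_def)
      then show ?thesis using apart that by (metis dist_commute)
    qed
    fix x assume x: "x \<in> U"
    \<comment> \<open>The first ball that contains \<open>x\<close> provides the index of the member that contains \<open>x\<close>.\<close>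
    define S where "S = {s \<in> U. x \<in> ball s (d s)}"
    have "x \<in> S" using x d by (simp add: S_def)
    then obtain s where s: "s \<in> S" "\<And>t. (t, s) \<in> r - Id \<Longrightarrow> t \<notin> S" using wfE_min[OF wf] by metis
    have "x \<in> ball s (d s)" using s by (simp add: S_def)
    then obtain e where e: "e > 0" "ball x e \<subseteq> ball s (d s)" by (meson open_ball open_contains_ball)
    obtain n where "inverse (real (Suc n)) < e" using reals_Archimedean[OF e(1)] by blast
    then have "ball x (1 / Suc n) \<subseteq> ball s (d s)" using e(2) by (auto simp: inverse_eq_divide)
    then have "x \<in> T n s" using s by (auto simp: T_def S_def)
    then show "\<exists>n s. x \<in> T n s" by blast
  qed (auto simp: T_def)
qed

text \<open>
  On level \<open>n\<close> of Stone's refinement the neighbourhoods \<open>W n s\<close> of the sets \<open>T n s\<close> are uniformly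
  apart, so a single cut-off \<open>h n\<close>, equal to \<open>1\<close> near all \<open>T n s\<close> and to \<open>0\<close> off all \<open>W n s\<close>, combines the functions
  \<open>F s\<close> into one smooth function \<open>E n\<close>. The levels are combined with the weights
  \<open>h n * (\<Prod>k<n. 1 - h k)\<close>. They sum to \<open>1\<close> by telescoping, and near each point of \<open>U\<close> all but finitely
  many vanish because some \<open>h n\<close> is \<open>1\<close> there.
\<close>
lemma C1_plus_loc_on_glue:
  fixes U A :: "'a::real_normed_vector set" and F :: "'a \<Rightarrow> 'a \<Rightarrow> real"
  assumes separation: "\<And>(P :: 'a set) Q \<rho>. \<lbrakk>\<rho> > 0; \<And>p q. \<lbrakk>p \<in> P; q \<in> Q\<rbrakk> \<Longrightarrow> \<rho> \<le> dist p q\<rbrakk> \<Longrightarrow>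
      \<exists>h. C1_plus_on UNIV h \<and> (\<forall>p\<in>P. h p = 1) \<and> (\<forall>q\<in>Q. h q = 0)"
    and U: "open U" "A \<subseteq> U"
    and d: "\<And>s. s \<in> U \<Longrightarrow> d s > 0"
    and F: "\<And>s. s \<in> U \<Longrightarrow> C1_plus_on UNIV (F s)"
    and Ff: "\<And>s x. \<lbrakk>s \<in> U; x \<in> A; x \<in> ball s (d s)\<rbrakk> \<Longrightarrow> F s x = f x"
  shows "\<exists>\<Phi>. C1_plus_loc_on U \<Phi> \<and> (\<forall>x\<in>A. \<Phi> x = f x)"
proof -
  obtain T :: "nat \<Rightarrow> 'a \<Rightarrow> 'a set" where
    T: "\<And>n s x. x \<in> T n s \<Longrightarrow> s \<in> U \<and> ball x (1 / Suc n) \<subseteq> ball s (d s)"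
    and apart: "\<And>n s t x y. \<lbrakk>x \<in> T n s; y \<in> T n t; s \<noteq> t\<rbrakk> \<Longrightarrow> 1 / Suc n \<le> dist x y"
    and cover: "\<And>x. x \<in> U \<Longrightarrow> \<exists>n s. x \<in> T n s"
    using Stone_sigma_discrete_refinement[of U d] d by metis
  define \<rho> where "\<rho> n = 1 / real (Suc n)" for n
  have \<rho>: "\<rho> n > 0" for n by (simp add: \<rho>_def)
  define P where "P n = (\<Union>s. \<Union>t\<in>T n s. ball t (\<rho> n / 8))" for n
  define W where "W n s = (\<Union>t\<in>T n s. ball t (\<rho> n / 4))" for n s
  have W_sub: "s \<in> U \<and> x \<in> ball s (d s)" if x: "x \<in> W n s" for x n s
  proof -
    obtain t where t: "t \<in> T n s" "x \<in> ball t (\<rho> n / 4)" using x by (auto simp: W_def)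
    then have "x \<in> ball t (\<rho> n)" using \<rho>[of n] by simp
    then show ?thesis using T[OF t(1)] unfolding \<rho>_def by blast
  qed
  have W_apart: "s = t" if ab: "a \<in> W n s" "b \<in> W n t" "dist a b < \<rho> n / 2" for n s t a b
  proof (rule ccontr)
    assume ne: "s \<noteq> t"
    obtain x y where xy: "x \<in> T n s" "dist x a < \<rho> n / 4" "y \<in> T n t" "dist y b < \<rho> n / 4"
      using ab by (auto simp: W_def)
    have "dist x y < \<rho> n"
      using xy ab(3) dist_triangle[of x y a] dist_triangle[of a y b] by (simp add: dist_commute)
    then show False using apart[OF xy(1,3) ne] by (simp add: \<rho>_def)
  qed
  have "\<exists>h. C1_plus_on UNIV h \<and> (\<forall>p\<in>P n. h p = 1) \<and> (\<forall>q\<in>- (\<Union>s. W n s). h q = 0)" for n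
  proof (rule separation[of "\<rho> n / 8"])
    fix p q assume p: "p \<in> P n" and q: "q \<in> - (\<Union>s. W n s)"
    obtain s t where t: "t \<in> T n s" "dist t p < \<rho> n / 8" using p by (auto simp: P_def)
    have "\<rho> n / 4 \<le> dist t q" using q t(1) by (auto simp: W_def not_less)
    then show "\<rho> n / 8 \<le> dist p q" using t(2) dist_triangle[of t q p] by linarith
  qed (use \<rho> in simp)
  then obtain h where H: "\<And>n. C1_plus_on UNIV (h n) \<and> (\<forall>p\<in>P n. h n p = 1)
      \<and> (\<forall>q\<in>- (\<Union>s. W n s). h n q = 0)"
    by metis
  have h: "C1_plus_on UNIV (h n)" and h1: "p \<in> P n \<Longrightarrow> h n p = 1"
    and h0: "(\<And>s. q \<notin> W n s) \<Longrightarrow> h n q = 0" for n p q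
    using H[of n] by blast+
  have h_near: "C1_plus_near x (h n)" for n x by (rule C1_plus_nearI[OF h]) auto
  \<comment> \<open>The value of \<open>THE\<close> matters only on the union of the \<open>W n s\<close>, where it is unique.\<close>
  define E where "E n x = (if \<exists>s. x \<in> W n s then h n x * F (THE s. x \<in> W n s) x else 0)" for n x
  have E_eq: "E n x = h n x * F s x" if "x \<in> W n s" for n x s
  proof -
    have "(THE s. x \<in> W n s) = s"
    proof (rule the_equality)
      show "x \<in> W n s" by (rule that)
      show "t = s" if "x \<in> W n t" for t
        using W_apart[OF that \<open>x \<in> W n s\<close>] \<rho>[of n] by simp
    qed
    moreover have "\<exists>s. x \<in> W n s" using that by blast
    ultimately show ?thesis unfolding E_def by presburger
  qed
  have E_near: "C1_plus_near x (E n)" for n x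
  proof (cases "\<exists>s. ball x (\<rho> n / 4) \<inter> W n s \<noteq> {}")
    case True
    then obtain s a where a: "dist x a < \<rho> n / 4" "a \<in> W n s" by auto
    have "C1_plus_near x (F s)" using F W_sub[OF a(2)] by (intro C1_plus_nearI[of UNIV]) auto
    then have near: "C1_plus_near x (\<lambda>y. h n y * F s y)" by (intro C1_plus_near_mult h_near)
    have "E n y = h n y * F s y" if y: "dist x y < \<rho> n / 4" for y
    proof (cases "\<exists>t. y \<in> W n t")
      case True
      then obtain t where t: "y \<in> W n t" by blast
      have "dist a y < \<rho> n / 2" using a(1) y dist_triangle3[of a y x] by (simp add: dist_commute)
      then have "s = t" using W_apart[OF a(2) t] by simp
      then show ?thesis using E_eq t by blast
    next
      case False
      then show ?thesis using h0[of y n] by (auto simp: E_def)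
    qed
    then show ?thesis using C1_plus_near_cong[OF near, of "\<rho> n / 4"] \<rho>[of n] by simp
  next
    case False
    have "E n y = 0" if "dist x y < \<rho> n / 4" for y
    proof -
      have "y \<in> ball x (\<rho> n / 4)" using that by simp
      then have "\<not> (\<exists>s. y \<in> W n s)" using False by blast
      then show ?thesis unfolding E_def by simp
    qed
    then show ?thesis
      using C1_plus_near_cong[OF C1_plus_near_const, of "\<rho> n / 4" x _ 0] \<rho>[of n] by simp
  qed
  have E_f: "E n x = h n x * f x" if "x \<in> A" for n x
  proof (cases "\<exists>s. x \<in> W n s")
    case True
    then obtain s where s: "x \<in> W n s" by blast
    then show ?thesis using E_eq[OF s] Ff[of s x] W_sub[OF s] that by simp
  next
    case False
    then show ?thesis using h0[of x n] by (auto simp: E_def)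
  qed
  define p where "p n x = (\<Prod>k<n. 1 - h k x)" for n x
  have p_near: "C1_plus_near x (p n)" for n x
    using C1_plus_near_add[OF C1_plus_near_const C1_plus_near_mult[OF C1_plus_near_const h_near], of x 1 "-1"]
    unfolding p_def by (intro C1_plus_near_prod) simp
  define \<Phi> where "\<Phi> x = (\<Sum>n. E n x * p n x)" for x
  have p_zero: "p k y = 0" if "y \<in> P n" "n < k" for k n y
    using h1[OF that(1)] that(2) by (auto simp: p_def)
  have \<Phi>_eq: "\<Phi> y = (\<Sum>k<Suc n. E k y * p k y)" if "y \<in> P n" for n y
    unfolding \<Phi>_def using p_zero[OF that] by (intro suminf_finite) auto
  have in_P: "\<exists>n. \<forall>y. dist x y < \<rho> n / 8 \<longrightarrow> y \<in> P n" if "x \<in> U" for x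
    using cover[OF that] by (auto simp: P_def)
  have "C1_plus_near x \<Phi>" if "x \<in> U" for x
  proof -
    obtain n where n: "\<And>y. dist x y < \<rho> n / 8 \<Longrightarrow> y \<in> P n" using in_P[OF \<open>x \<in> U\<close>] by blast
    have "C1_plus_near x (\<lambda>y. \<Sum>k<Suc n. E k y * p k y)"
      by (intro C1_plus_near_sum C1_plus_near_mult E_near p_near)
    then show ?thesis
      by (rule C1_plus_near_cong[of x _ "\<rho> n / 8"]) (use \<rho>[of n] n \<Phi>_eq in auto)
  qed
  moreover have "\<Phi> x = f x" if x: "x \<in> A" for x
  proof -
    obtain m where "\<And>y. dist x y < \<rho> m / 8 \<Longrightarrow> y \<in> P m" using in_P[OF subsetD[OF U(2) x]] by blast
    then have n: "x \<in> P m" using \<rho>[of m] by simp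
    have "\<Phi> x = (\<Sum>k<Suc m. h k x * p k x) * f x"
      unfolding \<Phi>_eq[OF n] sum_distrib_right by (intro sum.cong) (auto simp: E_f[OF x])
    also have "(\<Sum>k<Suc m. h k x * p k x) = 1 - p (Suc m) x"
      unfolding p_def by (rule sum_telescoping_complements)
    finally show ?thesis using p_zero[OF n, of "Suc m"] by simp
  qed
  ultimately show ?thesis using C1_plus_loc_on_iff_near[OF U(1)] by blast
qed

lemma (in uniformly_smooth_norm) C1_plus_separation:
  fixes P Q :: "'a set"
  assumes "\<rho> > 0" and apart: "\<And>p q. \<lbrakk>p \<in> P; q \<in> Q\<rbrakk> \<Longrightarrow> \<rho> \<le> dist p q"
  shows "\<exists>h. C1_plus_on UNIV h \<and> (\<forall>p\<in>P. h p = 1) \<and> (\<forall>q\<in>Q. h q = 0)"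
proof -
  define f :: "'a \<Rightarrow> real" where "f x = (if x \<in> P then 1 else 0)" for x
  have PQ: "q \<notin> P" if "q \<in> Q" for q using apart[of q q] that \<open>\<rho> > 0\<close> by auto
  have f_eq: "f x = f y" if "x \<in> P \<union> Q" "y \<in> P \<union> Q" "norm (y - x) < \<rho>" for x y
    using that apart[of x y] apart[of y x] PQ by (auto simp: f_def dist_norm norm_minus_commute)
  have "cond_W (P \<union> Q) f (\<lambda>x. 0)"
    unfolding cond_W_def
  proof (intro conjI allI impI exI[of _ \<rho>] ballI)
    fix e :: real and x y assume "e > 0" "x \<in> P \<union> Q" "y \<in> P \<union> Q" "norm (y - x) < \<rho>"
    then show "\<bar>f y - f x - blinfun_apply 0 (y - x)\<bar> \<le> e * norm (y - x)"
      using f_eq[of x y] by simp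
  qed (use \<open>\<rho> > 0\<close> in \<open>simp_all add: uniformly_continuous_on_const\<close>)
  moreover have "bounded (f ` (P \<union> Q))"
    by (rule finite_imp_bounded, rule finite_subset[of _ "{0, 1}"]) (auto simp: f_def)
  moreover have "bounded ((\<lambda>x. 0 :: 'a \<Rightarrow>\<^sub>L real) ` (P \<union> Q))"
    by (rule finite_imp_bounded, rule finite_subset[of _ "{0}"]) auto
  ultimately obtain h where "C1_plus_on UNIV h" "\<And>x. x \<in> P \<union> Q \<Longrightarrow> h x = f x"
    by (rule bounded_C1_plus_extension) blast
  then show ?thesis using PQ by (intro exI[of _ h]) (auto simp: f_def)
qed

section \<open>The extension theorem\<close>

lemma cond_W_if_C1_plus_near:
  assumes "C1_plus_near x F"
  shows "\<exists>d>0. \<exists>G :: 'a::real_normed_vector \<Rightarrow> 'a \<Rightarrow>\<^sub>L real.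
    bounded (F ` ball x d) \<and> bounded (G ` ball x d) \<and> cond_W (ball x d) F G"
proof -
  from assms obtain r B and D :: "'a \<Rightarrow> 'a \<Rightarrow>\<^sub>L real" where r: "r > 0"
    and D: "\<And>y. y \<in> ball x r \<Longrightarrow> (F has_derivative blinfun_apply (D y)) (at y)"
    and uD: "uniformly_continuous_on (ball x r) D"
    and DB: "\<And>y. y \<in> ball x r \<Longrightarrow> norm (D y) \<le> B" and FB: "\<And>y. y \<in> ball x r \<Longrightarrow> norm (F y) \<le> B"
    by (rule C1_plus_near_bounded) blast
  have "cond_W (ball x r) F D"
    unfolding cond_W_def
  proof (intro conjI uD allI impI)
    fix e :: real assume "e > 0"
    then obtain d where d: "d > 0"
      "\<And>y z. y \<in> ball x r \<Longrightarrow> z \<in> ball x r \<Longrightarrow> dist z y < d \<Longrightarrow> dist (D z) (D y) < e"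
      using uD unfolding uniformly_continuous_on_def by meson
    have "\<bar>F z - F y - D y (z - y)\<bar> \<le> e * norm (z - y)"
      if yz: "y \<in> ball x r" "z \<in> ball x r" "norm (z - y) < d" for y z
    proof -
      define S where "S = ball x r \<inter> ball y d"
      have S: "y \<in> S" "z \<in> S" using yz d(1) by (auto simp: S_def dist_norm norm_minus_commute)
      have "convex S" unfolding S_def by (intro convex_Int convex_ball)
      have "norm (F z - F y - D y (z - y)) \<le> norm (z - y) * e"
      proof (rule differentiable_bound_linearization[where S = S and f' = "\<lambda>u. blinfun_apply (D u)"])
        fix t :: real assume "t \<in> {0..1}"
        then have "(1 - t) *\<^sub>R y + t *\<^sub>R z \<in> S" using \<open>convex S\<close> S by (intro convexD_alt) auto
        then show "y + t *\<^sub>R (z - y) \<in> S" by (simp add: algebra_simps)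
      next
        fix u assume u: "u \<in> S"
        then show "(F has_derivative blinfun_apply (D u)) (at u within S)"
          using D by (auto simp: S_def intro: has_derivative_at_withinI)
        have "norm (D u - D y) \<le> e"
          using d(2)[of y u] u yz(1) by (auto simp: S_def dist_norm norm_minus_commute less_imp_le)
        then have "norm ((D u - D y) w) \<le> e * norm w" for w
          using norm_blinfun[of "D u - D y" w] mult_right_mono[of "norm (D u - D y)" e "norm w"] by simp
        then show "onorm (blinfun_apply (D u) - blinfun_apply (D y)) \<le> e"
          using \<open>e > 0\<close> by (intro onorm_bound) (auto simp: blinfun.bilinear_simps)
      qed (rule S)
      then show ?thesis by (simp add: mult.commute)
    qed
    with d(1) show "\<exists>d>0. \<forall>y\<in>ball x r. \<forall>z\<in>ball x r. norm (z - y) < d \<longrightarrow>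
        \<bar>F z - F y - D y (z - y)\<bar> \<le> e * norm (z - y)" by blast
  qed
  moreover have "bounded (F ` ball x r)" "bounded (D ` ball x r)"
    using FB DB by (auto intro!: boundedI)
  ultimately show ?thesis using r by blast
qed

lemma cond_W_subset:
  assumes "cond_W V F G" "E \<subseteq> V" "\<And>x. x \<in> E \<Longrightarrow> F x = f x"
  shows "cond_W E f G"
proof -
  have "uniformly_continuous_on E G"
    using assms(1,2) uniformly_continuous_on_subset unfolding cond_W_def by blast
  moreover have "\<exists>d>0. \<forall>x\<in>E. \<forall>y\<in>E. norm (y - x) < d \<longrightarrow> \<bar>f y - f x - G x (y - x)\<bar> \<le> e * norm (y - x)"
    if e: "e > 0" for e
  proof -
    obtain d where "d > 0" "\<And>x y. x \<in> V \<Longrightarrow> y \<in> V \<Longrightarrow> norm (y - x) < d \<Longrightarrow>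
        \<bar>F y - F x - G x (y - x)\<bar> \<le> e * norm (y - x)"
      using assms(1)[unfolded cond_W_def, THEN conjunct2] e by meson
    then show ?thesis using assms(2,3) by (intro exI[of _ d]) (metis subsetD)
  qed
  ultimately show ?thesis unfolding cond_W_def by blast
qed

theorem theorem65:
  fixes U A :: "'a::banach set" and f :: "'a \<Rightarrow> real"
  assumes "super_reflexive TYPE('a)"
    and "open U"
    and "closedin (top_of_set U) A"
  shows "(\<exists>F. C1_plus_loc_on U F \<and> (\<forall>x\<in>A. F x = f x)) \<longleftrightarrow>
    (locally_bounded_on A f \<and>
     (\<forall>x\<in>A. \<exists>d>0. \<exists>G :: 'a \<Rightarrow> ('a \<Rightarrow>\<^sub>L real).
        bounded (G ` (A \<inter> ball x d)) \<and> cond_W (A \<inter> ball x d) f G))"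
proof
  have AU: "A \<subseteq> U" using closedin_imp_subset[OF assms(3)] by simp
  assume "\<exists>F. C1_plus_loc_on U F \<and> (\<forall>x\<in>A. F x = f x)"
  then obtain F where F: "\<And>x. x \<in> U \<Longrightarrow> C1_plus_near x F" and Ff: "\<And>x. x \<in> A \<Longrightarrow> F x = f x"
    using C1_plus_loc_on_iff_near[OF assms(2)] by blast
  have "\<exists>d>0. \<exists>G :: 'a \<Rightarrow> ('a \<Rightarrow>\<^sub>L real).
      bounded (f ` (A \<inter> ball x d)) \<and> bounded (G ` (A \<inter> ball x d)) \<and> cond_W (A \<inter> ball x d) f G"
    if "x \<in> A" for x
  proof -
    obtain d and G :: "'a \<Rightarrow> 'a \<Rightarrow>\<^sub>L real" where d: "d > 0" and G: "bounded (F ` ball x d)"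
      "bounded (G ` ball x d)" "cond_W (ball x d) F G"
      using cond_W_if_C1_plus_near[OF F, of x] AU \<open>x \<in> A\<close> by blast
    have "f ` (A \<inter> ball x d) \<subseteq> F ` ball x d" using Ff by force
    then have "bounded (f ` (A \<inter> ball x d))" by (rule bounded_subset[OF G(1)])
    moreover have "bounded (G ` (A \<inter> ball x d))" by (rule bounded_subset[OF G(2)]) auto
    moreover have "cond_W (A \<inter> ball x d) f G" by (rule cond_W_subset[OF G(3)]) (auto simp: Ff)
    ultimately show ?thesis using d by blast
  qed
  then show "locally_bounded_on A f \<and> (\<forall>x\<in>A. \<exists>d>0. \<exists>G :: 'a \<Rightarrow> ('a \<Rightarrow>\<^sub>L real).
        bounded (G ` (A \<inter> ball x d)) \<and> cond_W (A \<inter> ball x d) f G)"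
    unfolding locally_bounded_on_def by (meson centre_in_ball open_ball)
next
  have AU: "A \<subseteq> U" using closedin_imp_subset[OF assms(3)] by simp
  assume rhs: "locally_bounded_on A f \<and> (\<forall>x\<in>A. \<exists>d>0. \<exists>G :: 'a \<Rightarrow> ('a \<Rightarrow>\<^sub>L real).
        bounded (G ` (A \<inter> ball x d)) \<and> cond_W (A \<inter> ball x d) f G)"
  obtain N :: "'a \<Rightarrow> real" where "equivalent_norm N" "uniformly_smooth N"
    using assms(1) unfolding super_reflexive_def by blast
  then obtain \<alpha> \<beta> where "uniformly_smooth_norm N \<alpha> \<beta>" by (rule uniformly_smooth_normI)
  then interpret uniformly_smooth_norm N \<alpha> \<beta> .
  have "\<exists>d>0. \<exists>F. C1_plus_on UNIV F \<and> (\<forall>x\<in>A \<inter> ball s d. F x = f x)" if s: "s \<in> U" for s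
  proof (cases "s \<in> A")
    case True
    obtain d1 and G :: "'a \<Rightarrow> 'a \<Rightarrow>\<^sub>L real" where d1: "d1 > 0" and G: "bounded (G ` (A \<inter> ball s d1))"
      "cond_W (A \<inter> ball s d1) f G" using rhs True by blast
    obtain V where V: "open V" "s \<in> V" "bounded (f ` (A \<inter> V))"
      using rhs True unfolding locally_bounded_on_def by blast
    obtain d2 where d2: "d2 > 0" "ball s d2 \<subseteq> V" using V by (meson open_contains_ball)
    define E where "E = A \<inter> ball s (min d1 d2)"
    have "cond_W E f G" by (rule cond_W_subset[OF G(2)]) (auto simp: E_def)
    moreover have "bounded (f ` E)" by (rule bounded_subset[OF V(3)]) (use d2 in \<open>auto simp: E_def\<close>)
    moreover have "bounded (G ` E)" by (rule bounded_subset[OF G(1)]) (auto simp: E_def)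
    ultimately obtain F where "C1_plus_on UNIV F" "\<And>x. x \<in> E \<Longrightarrow> F x = f x"
      by (rule bounded_C1_plus_extension) blast
    then show ?thesis using d1 d2 by (intro exI[of _ "min d1 d2"]) (auto simp: E_def)
  next
    case False
    obtain C where C: "closed C" "A = U \<inter> C" using assms(3) by (auto simp: closedin_closed)
    have "open (- C)" "s \<in> - C" using C False s by auto
    then obtain d where d: "d > 0" "ball s d \<subseteq> - C" by (meson open_contains_ball)
    then show ?thesis
      using C by (intro exI[of _ d] conjI exI[of _ "\<lambda>x. 0"] C1_plus_on_const) auto
  qed
  then obtain d F where d: "\<And>s. s \<in> U \<Longrightarrow> d s > 0" and F: "\<And>s. s \<in> U \<Longrightarrow> C1_plus_on UNIV (F s)"
    and Ff: "\<And>s x. s \<in> U \<Longrightarrow> x \<in> A \<Longrightarrow> x \<in> ball s (d s) \<Longrightarrow> F s x = f x"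
    by (metis IntI)
  show "\<exists>F. C1_plus_loc_on U F \<and> (\<forall>x\<in>A. F x = f x)"
    by (rule C1_plus_loc_on_glue[OF C1_plus_separation assms(2) AU d F Ff])
qed

end
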